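(* Let $r\ge2$ be a fixed integer, $a>b>0$ fixed, $n=rK$, and suppose $\sqrt a-\sqrt b<\sqrt r$. In the stochastic block model with $r$ clusters of equal size $K$, suppose the clusters are chosen uniformly at random among all partitions of $[n]$ into $r$ sets of size $K$. Then for any sequence of estimators $\widehat Z_n$ (functions of $A$), $\mathbb P\{\widehat Z_n=Z^*\}\to0$ as $n\to\infty$.
   Context: SBM with $r$ equal-sized clusters: given the partition of $[n]$ into clusters with indicator vectors $\xi^*_1,\dots,\xi^*_r$, each pair $\{i,j\}$ is independently connected with probability $p=a\log n/n$ if in the same cluster and $q=b\log n/n$ otherwise; $A$ is the adjacency matrix and $Z^*=\sum_k\xi^*_k(\xi^*_k)^\top$. *)

theory Defs
  imports "HOL-Probability.Probability" "Jordan_Normal_Form.Matrix"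
begin

definition equal_partitions :: "nat \<Rightarrow> nat \<Rightarrow> nat \<Rightarrow> nat set set set" where
  "equal_partitions n r K =
     {P. partition_on {..<n} P \<and> card P = r \<and> (\<forall>C\<in>P. card C = K)}"

definition same_cluster :: "nat set set \<Rightarrow> nat \<Rightarrow> nat \<Rightarrow> bool" where
  "same_cluster P i j \<longleftrightarrow> (\<exists>C\<in>P. i \<in> C \<and> j \<in> C)"

definition cluster_ind :: "nat \<Rightarrow> nat set \<Rightarrow> real vec" where
  "cluster_ind n C = vec n (\<lambda>i. if i \<in> C then 1 else 0)"

definition Zstar :: "nat \<Rightarrow> nat set set \<Rightarrow> real mat" where
  "Zstar n P = mat n n (\<lambda>(i, j). \<Sum>C\<in>P. cluster_ind n C $ i * cluster_ind n C $ j)"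

definition edge_pmf :: "nat \<Rightarrow> nat set set \<Rightarrow> real \<Rightarrow> real \<Rightarrow> (nat \<times> nat \<Rightarrow> bool) pmf" where
  "edge_pmf n P p q =
     Pi_pmf {(i, j). i < j \<and> j < n} False
       (\<lambda>(i, j). bernoulli_pmf (if same_cluster P i j then p else q))"

definition adj_of :: "nat \<Rightarrow> (nat \<times> nat \<Rightarrow> bool) \<Rightarrow> real mat" where
  "adj_of n E = mat n n (\<lambda>(i, j). if i \<noteq> j \<and> E (min i j, max i j) then 1 else 0)"

definition sbm_pmf :: "nat \<Rightarrow> nat \<Rightarrow> real \<Rightarrow> real \<Rightarrow> (nat set set \<times> real mat) pmf" where
  "sbm_pmf r K a b =
     (let n = r * K in
      do { P \<leftarrow> pmf_of_set (equal_partitions n r K);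
           E \<leftarrow> edge_pmf n P (a * ln (real n) / real n) (b * ln (real n) / real n);
           return_pmf (P, adj_of n E) })"

end

theory Submission
  imports Defs "HOL-Real_Asymp.Real_Asymp"
begin

text \<open>
  If \<open>M\<close> equal partitions explain the observed graph at least as well as the true one, then the
  posterior probability of the true partition is at most \<open>1 / M\<close>; so it suffices that such partitions
  are numerous with high probability. They arise by swapping two vertices of two fixed clusters, each
  of which has at least as many neighbours in the other cluster as in its own.

  Such vertices are sought in samples of \<open>m \<approx> K / ln\<^sup>2 n\<close> vertices per cluster. Up to the few edges
  inside the samples, the candidate events are independent with probability
  \<open>\<rho> = P (Bin (K - m, p) \<le> Bin (K - m, q))\<close>, and Chebyshev's inequality gives about \<open>m \<rho>\<close> of them.
  The geometric mean of the two binomial laws is a multiple of a binomial law of mean \<open>O (ln n)\<close>, so by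
  Cauchy-Schwarz \<open>\<rho>\<close> is at least their squared affinity up to a factor \<open>O (ln n)\<close>. Hence
  \<open>\<rho> \<ge> n powr (- c - o(1))\<close> with \<open>c = (sqrt a - sqrt b)\<^sup>2 / r < 1\<close>, and \<open>m \<rho>\<close> tends to infinity.
\<close>

section \<open>Posterior, independence and counting\<close>

text \<open>Bayes' rule under a uniform prior. Since \<open>Z\<close> is injective, an observation
  \<open>e\<close> can be decoded correctly for at most one hypothesis. If \<open>e\<close> is good
  for it, at least \<open>M\<close> hypotheses have no smaller likelihood, so its likelihood is at
  most a fraction \<open>1 / M\<close> of the total. Summing over \<open>e\<close> costs
  \<open>1 / M\<close> on average, and the bad events cost \<delta>.\<close>

lemma average_success_le:
  fixes \<mu> :: "'p \<Rightarrow> 'e pmf"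
  assumes S: "finite S" "S \<noteq> {}" and \<Omega>: "finite \<Omega>" "\<And>P. P \<in> S \<Longrightarrow> set_pmf (\<mu> P) \<subseteq> \<Omega>"
    and inj: "inj_on Z S" and M: "M > 0"
    and bad: "\<And>P. P \<in> S \<Longrightarrow> measure_pmf.prob (\<mu> P) (- G P) \<le> \<delta>"
    and many: "\<And>P e. P \<in> S \<Longrightarrow> e \<in> G P \<Longrightarrow> M \<le> real (card {P' \<in> S. pmf (\<mu> P) e \<le> pmf (\<mu> P') e})"
  shows "(\<Sum>P\<in>S. measure_pmf.prob (\<mu> P) {e. \<phi> e = Z P}) / real (card S) \<le> \<delta> + 1 / M"
proof -
  define A where "A e = {P \<in> S. e \<in> G P \<and> \<phi> e = Z P}" for e
  have pointwise: "(\<Sum>P\<in>A e. pmf (\<mu> P) e) \<le> (\<Sum>P\<in>S. pmf (\<mu> P) e) / M" for e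
  proof (cases "A e = {}")
    case True
    then show ?thesis using M by (simp add: sum_nonneg)
  next
    case False
    then obtain P where P: "P \<in> A e" by blast
    then have "A e = {P}" using inj by (auto simp: A_def inj_on_def)
    let ?Q = "{P' \<in> S. pmf (\<mu> P) e \<le> pmf (\<mu> P') e}"
    have "M * pmf (\<mu> P) e \<le> real (card ?Q) * pmf (\<mu> P) e"
      using many[of P e] P by (intro mult_right_mono) (auto simp: A_def)
    also have "\<dots> = (\<Sum>P'\<in>?Q. pmf (\<mu> P) e)" by simp
    also have "\<dots> \<le> (\<Sum>P'\<in>?Q. pmf (\<mu> P') e)" by (rule sum_mono) auto
    also have "\<dots> \<le> (\<Sum>P'\<in>S. pmf (\<mu> P') e)"
      using S by (intro sum_mono2) auto
    finally show ?thesis using M \<open>A e = {P}\<close> by (simp add: field_simps)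
  qed
  have split: "measure_pmf.prob (\<mu> P) {e. \<phi> e = Z P}
      \<le> \<delta> + (\<Sum>e\<in>\<Omega>. if P \<in> A e then pmf (\<mu> P) e else 0)" if "P \<in> S" for P
  proof -
    have "measure_pmf.prob (\<mu> P) {e. \<phi> e = Z P}
        \<le> measure_pmf.prob (\<mu> P) (- G P \<union> {e. P \<in> A e})"
      using that by (intro measure_pmf.finite_measure_mono) (auto simp: A_def)
    also have "\<dots> \<le> measure_pmf.prob (\<mu> P) (- G P) + measure_pmf.prob (\<mu> P) {e. P \<in> A e}"
      by (rule measure_Un_le) auto
    \<comment> \<open>Restricting to the finite set \<Omega> loses no mass and turns the probability
      into a finite sum, so that the sums over \<open>e\<close> and \<open>P\<close> can be
      exchanged below.\<close>
    also have "measure_pmf.prob (\<mu> P) {e. P \<in> A e} = measure_pmf.prob (\<mu> P) {e \<in> \<Omega>. P \<in> A e}"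
      using \<Omega>(2)[OF that] by (intro measure_prob_cong_0) (auto simp: set_pmf_iff)
    also have "\<dots> = (\<Sum>e\<in>\<Omega>. if P \<in> A e then pmf (\<mu> P) e else 0)"
      using \<Omega>(1) by (simp add: measure_measure_pmf_finite sum.inter_filter)
    finally show ?thesis using bad[OF that] by simp
  qed
  have "(\<Sum>P\<in>S. measure_pmf.prob (\<mu> P) {e. \<phi> e = Z P})
      \<le> (\<Sum>P\<in>S. \<delta> + (\<Sum>e\<in>\<Omega>. if P \<in> A e then pmf (\<mu> P) e else 0))"
    by (rule sum_mono) (rule split)
  also have "\<dots> = card S * \<delta> + (\<Sum>e\<in>\<Omega>. \<Sum>P\<in>S. if P \<in> A e then pmf (\<mu> P) e else 0)"
    by (simp add: sum.distrib sum.swap[of _ S])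
  also have "(\<Sum>e\<in>\<Omega>. \<Sum>P\<in>S. if P \<in> A e then pmf (\<mu> P) e else 0) = (\<Sum>e\<in>\<Omega>. \<Sum>P\<in>A e. pmf (\<mu> P) e)"
    using S(1) by (intro sum.cong[OF refl]) (simp add: A_def sum.inter_filter)
  also have "\<dots> \<le> (\<Sum>e\<in>\<Omega>. (\<Sum>P\<in>S. pmf (\<mu> P) e) / M)"
    by (rule sum_mono) (rule pointwise)
  also have "\<dots> = (\<Sum>P\<in>S. \<Sum>e\<in>\<Omega>. pmf (\<mu> P) e) / M"
    by (simp add: sum_divide_distrib[symmetric] sum.swap[of _ S])
  also have "(\<Sum>P\<in>S. \<Sum>e\<in>\<Omega>. pmf (\<mu> P) e) = (\<Sum>P\<in>S. 1)"
    using \<Omega> by (intro sum.cong refl sum_pmf_eq_1) auto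
  finally have "(\<Sum>P\<in>S. measure_pmf.prob (\<mu> P) {e. \<phi> e = Z P}) \<le> card S * (\<delta> + 1 / M)"
    by (simp add: algebra_simps)
  moreover have "card S > 0" using S by (simp add: card_gt_0_iff)
  ultimately show ?thesis by (simp add: field_simps)
qed

text \<open>The product law splits into independent factors over \<open>A\<close> and
  \<open>D - A\<close>. \<open>F\<close> reads only the first, and \<open>G\<close> only the second
  because \<open>B\<close> avoids \<open>A\<close>.\<close>

lemma Pi_pmf_map_pair_indep:
  assumes D: "finite D" "A \<subseteq> D" and AB: "A \<inter> B = {}"
    and F: "\<And>f g. (\<And>x. x \<in> A \<Longrightarrow> f x = g x) \<Longrightarrow> F f = F g"
    and G: "\<And>f g. (\<And>x. x \<in> B \<Longrightarrow> f x = g x) \<Longrightarrow> G f = G g"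
  shows "map_pmf (\<lambda>f. (F f, G f)) (Pi_pmf D d \<mu>) =
           pair_pmf (map_pmf F (Pi_pmf D d \<mu>)) (map_pmf G (Pi_pmf D d \<mu>))"
proof -
  have D_eq: "Pi_pmf D d \<mu> = map_pmf (\<lambda>(f, g) x. if x \<in> A then f x else g x)
      (pair_pmf (Pi_pmf A d \<mu>) (Pi_pmf (D - A) d \<mu>))"
    using Pi_pmf_union[of A "D - A" d \<mu>] D by (simp add: finite_subset Un_absorb1)
  have 1: "F (\<lambda>x. if x \<in> A then f x else g x) = F f" for f g by (rule F) auto
  have 2: "G (\<lambda>x. if x \<in> A then f x else g x) = G g" for f g using AB by (intro G) auto
  have pair: "map_pmf (\<lambda>f. (F f, G f)) (Pi_pmf D d \<mu>) =
      pair_pmf (map_pmf F (Pi_pmf A d \<mu>)) (map_pmf G (Pi_pmf (D - A) d \<mu>))"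
    by (simp add: D_eq map_pmf_comp case_prod_unfold 1 2 flip: map_pair)
  \<comment> \<open>Projecting the factorisation to either component shows that the marginals under
    the partial products agree with those under the full one.\<close>
  have "map_pmf F (Pi_pmf D d \<mu>) = map_pmf F (Pi_pmf A d \<mu>)"
    using arg_cong[OF pair, of "map_pmf fst"] by (simp add: map_pmf_comp map_fst_pair_pmf)
  moreover have "map_pmf G (Pi_pmf D d \<mu>) = map_pmf G (Pi_pmf (D - A) d \<mu>)"
    using arg_cong[OF pair, of "map_pmf snd"] by (simp add: map_pmf_comp map_snd_pair_pmf)
  ultimately show ?thesis using pair by simp
qed

lemma Pi_pmf_prob_indep:
  assumes "finite D" "A \<subseteq> D" "A \<inter> B = {}"
    and "\<And>f g. (\<And>x. x \<in> A \<Longrightarrow> f x = g x) \<Longrightarrow> F f = F g"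
    and "\<And>f g. (\<And>x. x \<in> B \<Longrightarrow> f x = g x) \<Longrightarrow> G f = G g"
  shows "measure_pmf.prob (Pi_pmf D d \<mu>) {f. F f \<and> G f} =
           measure_pmf.prob (Pi_pmf D d \<mu>) {f. F f} * measure_pmf.prob (Pi_pmf D d \<mu>) {f. G f}"
proof -
  have "measure_pmf.prob (Pi_pmf D d \<mu>) {f. F f \<and> G f}
      = measure_pmf.prob (map_pmf (\<lambda>f. (F f, G f)) (Pi_pmf D d \<mu>)) {(True, True)}"
    by (simp add: vimage_def)
  also have "\<dots> = pmf (map_pmf F (Pi_pmf D d \<mu>)) True * pmf (map_pmf G (Pi_pmf D d \<mu>)) True"
    by (subst Pi_pmf_map_pair_indep[OF assms]) (simp_all add: measure_pmf_single pmf_pair)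
  finally show ?thesis by (simp add: pmf_map vimage_def)
qed

text \<open>Chebyshev's argument centred at \<open>card I * \<rho>\<close>, the mean count of the
  \<open>X i\<close>, although the \<open>Y i\<close> are counted. Pairwise independence of the
  \<open>X i\<close> bounds the second moment from above through \<open>Y i \<subseteq> X i\<close>;
  the first moment is bounded from below through \<open>s\<close>. The mismatch of centre and mean
  produces the term \<open>8 * (1 - s)\<close>.\<close>

lemma prob_count_le_half_mean:
  fixes p :: "'e pmf" and X Y :: "'i \<Rightarrow> 'e set" and \<rho> s :: real
  assumes I: "finite I" "I \<noteq> {}" and \<rho>: "\<rho> > 0"
    and X: "\<And>i. i \<in> I \<Longrightarrow> measure_pmf.prob p (X i) = \<rho>"
    and XX: "\<And>i j. i \<in> I \<Longrightarrow> j \<in> I \<Longrightarrow> i \<noteq> j \<Longrightarrow> measure_pmf.prob p (X i \<inter> X j) = \<rho>\<^sup>2"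
    and Y: "\<And>i. i \<in> I \<Longrightarrow> Y i \<subseteq> X i"
    and Ys: "\<And>i. i \<in> I \<Longrightarrow> measure_pmf.prob p (Y i) \<ge> \<rho> * s"
  shows "measure_pmf.prob p {e. real (card {i \<in> I. e \<in> Y i}) \<le> card I * \<rho> / 2}
           \<le> 4 / (card I * \<rho>) + 8 * (1 - s)"
proof -
  define m where "m = real (card I)"
  have m: "m > 0" using I by (simp add: m_def card_gt_0_iff)
  define W where "W e = (\<Sum>i\<in>I. indicator (Y i) e :: real)" for e
  have W: "W e = real (card {i \<in> I. e \<in> Y i})" for e
    using I(1) by (simp add: W_def indicator_def sum.inter_filter[symmetric] Int_def)
  have int_ind: "integrable (measure_pmf p) (indicator B :: 'e \<Rightarrow> real)" for B
    by (rule measure_pmf.integrable_const_bound[where B = 1]) auto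
  have intW: "integrable (measure_pmf p) W"
    unfolding W_def by (intro Bochner_Integration.integrable_sum int_ind)
  have W2: "(W e)\<^sup>2 = (\<Sum>i\<in>I. \<Sum>j\<in>I. indicator (Y i \<inter> Y j) e)" for e
    by (simp add: W_def power2_eq_square sum_product indicator_inter_arith)
  have intW2: "integrable (measure_pmf p) (\<lambda>e. (W e)\<^sup>2)"
    unfolding W2 by (intro Bochner_Integration.integrable_sum int_ind)
  have EW: "measure_pmf.expectation p W \<ge> m * (\<rho> * s)"
  proof -
    have "measure_pmf.expectation p W = (\<Sum>i\<in>I. measure_pmf.prob p (Y i))"
      unfolding W_def by (simp add: Bochner_Integration.integral_sum int_ind)
    also have "\<dots> \<ge> (\<Sum>i\<in>I. \<rho> * s)" by (intro sum_mono Ys)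
    finally show ?thesis by (simp add: m_def)
  qed
  have EW2: "measure_pmf.expectation p (\<lambda>e. (W e)\<^sup>2) \<le> m * \<rho> + m\<^sup>2 * \<rho>\<^sup>2"
  proof -
    have "measure_pmf.expectation p (\<lambda>e. (W e)\<^sup>2) = (\<Sum>i\<in>I. \<Sum>j\<in>I. measure_pmf.prob p (Y i \<inter> Y j))"
      unfolding W2 by (simp add: Bochner_Integration.integral_sum int_ind Bochner_Integration.integrable_sum)
    also have "\<dots> \<le> (\<Sum>i\<in>I. \<Sum>j\<in>I. (if i = j then \<rho> else 0) + \<rho>\<^sup>2)"
    proof (intro sum_mono)
      fix i j assume ij: "i \<in> I" "j \<in> I"
      have "measure_pmf.prob p (Y i \<inter> Y j) \<le> measure_pmf.prob p (X i \<inter> X j)"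
        using Y ij by (intro measure_pmf.finite_measure_mono) auto
      then show "measure_pmf.prob p (Y i \<inter> Y j) \<le> (if i = j then \<rho> else 0) + \<rho>\<^sup>2"
        using X XX ij by (cases "i = j") (auto intro: order_trans)
    qed
    also have "\<dots> = m * \<rho> + m\<^sup>2 * \<rho>\<^sup>2"
      using I(1) by (simp add: sum.distrib m_def power2_eq_square algebra_simps)
    finally show ?thesis .
  qed
  have sq: "(W e - m * \<rho>)\<^sup>2 = (W e)\<^sup>2 - 2 * (m * \<rho>) * W e + (m * \<rho>)\<^sup>2" for e
    by (simp add: power2_diff algebra_simps)
  have "measure_pmf.prob p {e. real (card {i \<in> I. e \<in> Y i}) \<le> m * \<rho> / 2}
      \<le> measure_pmf.prob p {e \<in> space (measure_pmf p). \<bar>W e - m * \<rho>\<bar> \<ge> m * \<rho> / 2}"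
    using m \<rho> by (intro measure_pmf.finite_measure_mono) (auto simp: W mult.commute)
  also have "\<dots> \<le> measure_pmf.expectation p (\<lambda>e. (W e - m * \<rho>)\<^sup>2) / (m * \<rho> / 2)\<^sup>2"
    using m \<rho> intW intW2 by (intro measure_pmf.second_moment_method) (auto simp: sq)
  also have "measure_pmf.expectation p (\<lambda>e. (W e - m * \<rho>)\<^sup>2)
      = measure_pmf.expectation p (\<lambda>e. (W e)\<^sup>2) - 2 * (m * \<rho>) * measure_pmf.expectation p W + (m * \<rho>)\<^sup>2"
    using intW intW2 by (simp add: sq)
  also have "\<dots> \<le> (m * \<rho> + m\<^sup>2 * \<rho>\<^sup>2) - 2 * (m * \<rho>) * (m * (\<rho> * s)) + (m * \<rho>)\<^sup>2"
    using EW EW2 m \<rho> by (intro add_mono diff_mono mult_left_mono) auto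
  also have "\<dots> / (m * \<rho> / 2)\<^sup>2 = 4 / (m * \<rho>) + 8 * (1 - s)"
    using m \<rho> by (simp add: field_simps power2_eq_square)
  finally show ?thesis using m \<rho> by (simp add: m_def divide_right_mono)
qed

text \<open>Here \<open>h\<close> is the affinity of the two Bernoulli laws. The event is reduced to
  ties \<open>u = v = t\<close>, whose probability is \<open>h ^ (2 * N)\<close> times the square of
  a binomial mass with success probability \<open>s = sqrt (p * q) / h\<close>. Cauchy-Schwarz on
  the values \<open>t\<close> up to twice the mean \<open>N * s\<close> bounds the sum of these
  squares from below.\<close>

lemma prob_binomial_le_binomial_ge:
  fixes p q :: real
  assumes p: "0 < p" "p < 1" and q: "0 < q" "q < 1"
  defines "h \<equiv> sqrt (p * q) + sqrt ((1 - p) * (1 - q))"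
  shows "measure_pmf.prob (pair_pmf (binomial_pmf N p) (binomial_pmf N q)) {(u, v). u \<le> v}
           \<ge> h ^ (2 * N) / (4 * (2 * N * (sqrt (p * q) / h) + 1))"
proof -
  define s where "s = sqrt (p * q) / h"
  have pos: "sqrt (p * q) > 0" "sqrt ((1 - p) * (1 - q)) > 0" using p q by auto
  then have h: "h > 0" unfolding h_def by (rule add_pos_pos)
  have s: "0 < s" "s < 1" using pos h by (auto simp: s_def h_def field_simps)
  have s1: "1 - s = sqrt ((1 - p) * (1 - q)) / h"
    using h by (simp add: s_def diff_divide_eq_iff) (simp add: h_def)
  define \<nu> where "\<nu> t = pmf (binomial_pmf N s) t" for t
  \<comment> \<open>The geometric mean of the two binomial laws is, up to normalisation, again binomial.\<close>
  have tilt: "pmf (binomial_pmf N p) t * pmf (binomial_pmf N q) t = h ^ (2 * N) * (\<nu> t)\<^sup>2"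
    if "t \<le> N" for t
  proof -
    have "(s ^ t)\<^sup>2 = (s\<^sup>2) ^ t" "((1 - s) ^ (N - t))\<^sup>2 = ((1 - s)\<^sup>2) ^ (N - t)"
      by (simp_all add: power_mult[symmetric] mult.commute)
    moreover have "s\<^sup>2 = p * q / h\<^sup>2" "(1 - s)\<^sup>2 = (1 - p) * (1 - q) / h\<^sup>2"
      using p q unfolding s1 by (simp_all add: s_def power_divide)
    moreover have "h ^ (2 * N) = (h\<^sup>2) ^ t * (h\<^sup>2) ^ (N - t)"
      using that by (simp add: power_mult power_add[symmetric])
    ultimately show ?thesis using p q s h
      by (simp add: \<nu>_def power_mult_distrib power_divide)
         (simp add: power2_eq_square field_simps)
  qed
  \<comment> \<open>The cutoff at twice the mean keeps at least half of the mass by Markov's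
    inequality, while only about \<open>2 * N * s\<close> values remain.\<close>
  define T where "T = {t. t \<le> N \<and> real t \<le> 2 * N * s}"
  have finT: "finite T" by (simp add: T_def)
  have cardT: "real (card T) \<le> 2 * N * s + 1"
  proof -
    have "T \<subseteq> {..nat \<lfloor>2 * N * s\<rfloor>}" using s by (auto simp: T_def le_nat_floor)
    then have "card T \<le> card {..nat \<lfloor>2 * N * s\<rfloor>}" by (intro card_mono) auto
    also have "\<dots> = nat \<lfloor>2 * N * s\<rfloor> + 1" by simp
    finally have "real (card T) \<le> real (nat \<lfloor>2 * N * s\<rfloor>) + 1" by linarith
    moreover have "real (nat \<lfloor>2 * N * s\<rfloor>) \<le> 2 * N * s" using s by (simp add: of_nat_nat)
    ultimately show ?thesis by linarith
  qed
  have half: "(\<Sum>t\<in>T. \<nu> t) \<ge> 1 / 2"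
  \<comment> \<open>Markov's inequality divides by the cutoff \<open>2 * N * s\<close>, which
    vanishes for \<open>N = 0\<close>.\<close>
  proof (cases "N = 0")
    case True
    then have "T = {0}" by (auto simp: T_def)
    then show ?thesis using True s by (simp add: \<nu>_def)
  next
    case False
    have "measure_pmf.prob (binomial_pmf N s) (- T)
        \<le> measure_pmf.prob (binomial_pmf N s) {t \<in> space (measure_pmf (binomial_pmf N s)). real t \<ge> 2 * N * s}"
      using s by (intro measure_pmf.finite_measure_mono_AE) (auto simp: T_def AE_measure_pmf_iff)
    also have "\<dots> \<le> measure_pmf.expectation (binomial_pmf N s) real / (2 * N * s)"
      using False s
      by (intro integral_Markov_inequality_measure[where A = UNIV])
         (auto intro!: integrable_measure_pmf_finite)
    also have "measure_pmf.expectation (binomial_pmf N s) real = N * s"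
      using s sum_k_Bernstein[of N s]
      by (simp add: expectation_binomial_pmf' Bernstein_def mult_ac)
    also have "N * s / (2 * N * s) = 1 / 2" using False s by simp
    finally have "measure_pmf.prob (binomial_pmf N s) (- T) \<le> 1 / 2" .
    then have "measure_pmf.prob (binomial_pmf N s) T \<ge> 1 / 2"
      using measure_pmf.prob_compl[of T "binomial_pmf N s"] by (simp add: Compl_eq_Diff_UNIV)
    then show ?thesis using finT by (simp add: measure_measure_pmf_finite \<nu>_def)
  qed
  have "1 / 4 \<le> (\<Sum>t\<in>T. \<nu> t)\<^sup>2"
    using power_mono[OF half, of 2] by (simp add: power2_eq_square)
  also have "\<dots> \<le> (\<Sum>t\<in>T. (\<nu> t)\<^sup>2) * card T" by (rule sum_squared_le_sum_of_squares)
  also have "\<dots> \<le> (\<Sum>t\<in>T. (\<nu> t)\<^sup>2) * (2 * N * s + 1)"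
    using cardT by (intro mult_left_mono sum_nonneg) auto
  finally have CS: "1 / (4 * (2 * N * s + 1)) \<le> (\<Sum>t\<in>T. (\<nu> t)\<^sup>2)"
    using s by (simp add: field_simps add_pos_nonneg)
  have "h ^ (2 * N) / (4 * (2 * N * s + 1)) \<le> h ^ (2 * N) * (\<Sum>t\<in>T. (\<nu> t)\<^sup>2)"
    using mult_left_mono[OF CS, of "h ^ (2 * N)"] h by simp
  also have "\<dots> = (\<Sum>t\<in>T. pmf (binomial_pmf N p) t * pmf (binomial_pmf N q) t)"
    by (subst sum_distrib_left) (intro sum.cong refl tilt[symmetric], simp add: T_def)
  also have "\<dots> = (\<Sum>x\<in>(\<lambda>t. (t, t)) ` T. pmf (pair_pmf (binomial_pmf N p) (binomial_pmf N q)) x)"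
    by (subst sum.reindex) (auto simp: inj_on_def pmf_pair)
  also have "\<dots> = measure_pmf.prob (pair_pmf (binomial_pmf N p) (binomial_pmf N q)) ((\<lambda>t. (t, t)) ` T)"
    using finT by (simp add: measure_measure_pmf_finite)
  also have "\<dots> \<le> measure_pmf.prob (pair_pmf (binomial_pmf N p) (binomial_pmf N q)) {(u, v). u \<le> v}"
    by (intro measure_pmf.finite_measure_mono) auto
  finally show ?thesis by (simp add: s_def)
qed

section \<open>Equal partitions and swaps\<close>

text \<open>Edges are sampled only at ordered slots \<open>(i, j)\<close> with \<open>i < j\<close>,
  so the endpoints are sorted.\<close>

definition edge :: "nat \<Rightarrow> nat \<Rightarrow> nat \<times> nat" where
  "edge i j = (min i j, max i j)"

definition internal_edges :: "(nat \<times> nat \<Rightarrow> bool) \<Rightarrow> nat set \<Rightarrow> nat" where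
  "internal_edges E C = card {(u, v). u \<in> C \<and> v \<in> C \<and> u < v \<and> E (u, v)}"

definition nbrs :: "(nat \<times> nat \<Rightarrow> bool) \<Rightarrow> nat \<Rightarrow> nat set \<Rightarrow> nat" where
  "nbrs E i S = card {v \<in> S. E (edge i v)}"

definition swap :: "nat set set \<Rightarrow> nat set \<Rightarrow> nat set \<Rightarrow> nat \<Rightarrow> nat \<Rightarrow> nat set set" where
  "swap P C C' i j = insert (insert j (C - {i})) (insert (insert i (C' - {j})) (P - {C, C'}))"

lemma inj_edge: "inj (edge i)"
  by (auto simp: inj_on_def edge_def min_def max_def split: if_splits)

lemma edge_eq_iff: "edge i u = edge j v \<longleftrightarrow> i = j \<and> u = v \<or> i = v \<and> u = j"
  by (auto simp: edge_def min_def max_def)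

text \<open>The new internal edges are the \<open>edge j v\<close> with \<open>v \<in> C\<close>,
  one for each neighbour since \<open>edge j\<close> is injective. All bookkeeping for swaps rests
  on this identity.\<close>

lemma internal_edges_insert:
  assumes "finite C" "j \<notin> C"
  shows "internal_edges E (insert j C) = internal_edges E C + nbrs E j C"
proof -
  let ?A = "{(u, v). u \<in> C \<and> v \<in> C \<and> u < v \<and> E (u, v)}"
  let ?B = "edge j ` {v \<in> C. E (edge j v)}"
  have fin: "finite ?A" by (rule finite_subset[of _ "C \<times> C"]) (use assms in auto)
  have eq: "{(u, v). u \<in> insert j C \<and> v \<in> insert j C \<and> u < v \<and> E (u, v)} = ?A \<union> ?B" (is "?L = _")
  proof (intro equalityI subsetI)
    fix x assume "x \<in> ?L"
    then obtain u v where x: "x = (u, v)" "u \<in> insert j C" "v \<in> insert j C" "u < v" "E (u, v)"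
      by auto
    consider "u \<in> C" "v \<in> C" | "u = j" "v \<in> C" | "v = j" "u \<in> C" using x by auto
    then show "x \<in> ?A \<union> ?B"
    proof cases
      case 2
      then have "x \<in> ?B"
        using x by (intro image_eqI[where x = v]) (simp_all add: edge_def)
      then show ?thesis by simp
    next
      case 3
      then have "x \<in> ?B"
        using x by (intro image_eqI[where x = u]) (simp_all add: edge_def)
      then show ?thesis by simp
    qed (use x in simp)
  next
    fix x assume "x \<in> ?A \<union> ?B"
    then show "x \<in> ?L"
    proof
      assume "x \<in> ?B"
      then obtain v where "v \<in> C" "E (edge j v)" "x = edge j v" by auto
      moreover have "v \<noteq> j" using \<open>v \<in> C\<close> assms by auto
      ultimately show ?thesis by (auto simp: edge_def min_def max_def)
    qed auto
  qed
  have "?A \<inter> ?B = {}" using assms by (auto simp: edge_def min_def max_def split: if_splits)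
  then have "card (?A \<union> ?B) = card ?A + card ?B"
    using fin assms by (intro card_Un_disjoint) auto
  also have "card ?B = nbrs E j C"
    unfolding nbrs_def by (intro card_image inj_on_subset[OF inj_edge]) auto
  finally show ?thesis unfolding internal_edges_def eq .
qed

text \<open>The complete graph turns the edge count into the number of slots inside a cluster, which
  is later the total exponent in the likelihood.\<close>

lemma internal_edges_complete: "finite C \<Longrightarrow> internal_edges (\<lambda>_. True) C = card C choose 2"
proof (induction rule: finite_induct)
  case empty
  then show ?case by (simp add: internal_edges_def)
next
  case (insert j C)
  then show ?case
    by (simp add: internal_edges_insert nbrs_def numeral_2_eq_2)
qed

section \<open>Structure of equal partitions and of their cluster matrices\<close>

lemma equal_partitionsD:
  assumes "P \<in> equal_partitions n r K"
  shows "\<Union>P = {..<n}" "disjoint P" "finite P" "card P = r" "C \<in> P \<Longrightarrow> card C = K"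
    "C \<in> P \<Longrightarrow> finite C" "C \<in> P \<Longrightarrow> C \<subseteq> {..<n}"
proof -
  have part: "partition_on {..<n} P" "card P = r" "\<forall>C\<in>P. card C = K"
    using assms by (auto simp: equal_partitions_def)
  show "\<Union>P = {..<n}" "disjoint P" using part(1) by (auto simp: partition_on_def)
  then show sub: "C \<in> P \<Longrightarrow> C \<subseteq> {..<n}" by auto
  show "finite P" using finite_elements[OF _ part(1)] by simp
  show "card P = r" "C \<in> P \<Longrightarrow> card C = K" using part by auto
  show "C \<in> P \<Longrightarrow> finite C" using sub finite_subset by blast
qed

lemma equal_partitions_unique:
  assumes "P \<in> equal_partitions n r K" "C \<in> P" "C' \<in> P" "i \<in> C" "i \<in> C'"
  shows "C = C'"
  using equal_partitionsD(2)[OF assms(1)] assms(2-) by (auto simp: pairwise_def disjnt_iff)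

lemma finite_equal_partitions: "finite (equal_partitions n r K)"
  by (rule finite_subset[OF _ finitely_many_partition_on[of "{..<n}"]])
     (auto simp: equal_partitions_def)

text \<open>Consecutive blocks of length \<open>K\<close> form such a partition. Nonemptiness is
  what gives \<open>pmf_of_set\<close> its meaning as the uniform law.\<close>

lemma equal_partitions_nonempty:
  assumes "K > 0"
  shows "equal_partitions (r * K) r K \<noteq> {}"
proof -
  define B where "B k = {k * K..<(k + 1) * K}" for k
  have mem: "u \<in> B k \<longleftrightarrow> u div K = k" for u k
    using assms dividend_less_times_div[of K u] div_times_less_eq_dividend[of u K]
    by (auto simp: B_def mult.commute intro!: div_nat_eqI)
  have card: "card (B k) = K" for k by (simp add: B_def)
  have disj: "k = l" if "B k \<inter> B l \<noteq> {}" for k l using that by (auto simp: mem)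
  have ne: "B k \<noteq> {}" for k using card[of k] assms by auto
  have inj: "inj B" using disj ne by (intro injI) (metis inf.idem)
  have "\<Union>(B ` {..<r}) = {..<r * K}"
    using assms by (auto simp: mem less_mult_imp_div_less div_less_iff_less_mult)
  then have "partition_on {..<r * K} (B ` {..<r})"
    unfolding partition_on_def using ne by (auto simp: pairwise_def disjnt_iff mem image_iff)
  then have "B ` {..<r} \<in> equal_partitions (r * K) r K"
    using card inj by (auto simp: equal_partitions_def card_image inj_on_subset)
  then show ?thesis by blast
qed

lemma Zstar_index:
  assumes "P \<in> equal_partitions n r K" "i < n" "j < n"
  shows "Zstar n P $$ (i, j) = (if same_cluster P i j then 1 else 0)"
proof (cases "same_cluster P i j")
  case True
  then obtain C where C: "C \<in> P" "i \<in> C" "j \<in> C" by (auto simp: same_cluster_def)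
  have "(\<Sum>C\<in>P. cluster_ind n C $ i * cluster_ind n C $ j) = (\<Sum>C'\<in>P. if C' = C then 1 else 0)"
    using assms C equal_partitions_unique[OF assms(1)]
    by (intro sum.cong refl) (auto simp: cluster_ind_def)
  then show ?thesis
    using True assms C equal_partitionsD(3)[OF assms(1)] by (simp add: Zstar_def)
next
  case False
  then have "(\<Sum>C\<in>P. cluster_ind n C $ i * cluster_ind n C $ j) = 0"
    using assms by (intro sum.neutral) (auto simp: cluster_ind_def same_cluster_def)
  then show ?thesis using False assms by (simp add: Zstar_def)
qed

text \<open>The matrix encodes the relation \<open>same_cluster\<close>, and a cluster is the class
  of any of its vertices; \<open>K > 0\<close> guarantees that there is one.\<close>

lemma inj_on_Zstar:
  assumes "K > 0"
  shows "inj_on (Zstar n) (equal_partitions n r K)"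
proof (rule inj_onI)
  have sub: "P \<subseteq> Q" if P: "P \<in> equal_partitions n r K" and Q: "Q \<in> equal_partitions n r K"
    and Z: "Zstar n P = Zstar n Q" for P Q
  proof
    fix C assume C: "C \<in> P"
    have "card C = K" using equal_partitionsD(5)[OF P C] .
    then obtain i where i: "i \<in> C" using assms by fastforce
    have in_n: "C \<subseteq> {..<n}" using equal_partitionsD(7)[OF P C] .
    then obtain C' where C': "C' \<in> Q" "i \<in> C'"
      using i equal_partitionsD(1)[OF Q] by blast
    have in_n': "C' \<subseteq> {..<n}" using equal_partitionsD(7)[OF Q C'(1)] .
    have same: "same_cluster P i j \<longleftrightarrow> same_cluster Q i j" if "j < n" for j
      using Zstar_index[OF P, of i j] Zstar_index[OF Q, of i j] Z that in_n i
      by (auto split: if_splits)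
    have 1: "j \<in> C \<longleftrightarrow> same_cluster P i j" for j
      using C i equal_partitions_unique[OF P] by (auto simp: same_cluster_def)
    have 2: "j \<in> C' \<longleftrightarrow> same_cluster Q i j" for j
      using C' equal_partitions_unique[OF Q] by (auto simp: same_cluster_def)
    have "C = C'" using same 1 2 in_n in_n' by blast
    then show "C \<in> Q" using C' by simp
  qed
  fix P Q assume "P \<in> equal_partitions n r K" "Q \<in> equal_partitions n r K" "Zstar n P = Zstar n Q"
  then show "P = Q" using sub[of P Q] sub[of Q P] by auto
qed

lemma pairwise_disjnt_insertI:
  "pairwise disjnt X \<Longrightarrow> (\<And>B. B \<in> X \<Longrightarrow> disjnt A B) \<Longrightarrow> pairwise disjnt (insert A X)"
  by (auto simp: pairwise_insert disjnt_sym)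

section \<open>Swapping two vertices between clusters\<close>

context
  fixes P n r K C C' i j
  assumes P: "P \<in> equal_partitions n r K"
    and C: "C \<in> P" "C' \<in> P" "C \<noteq> C'" and ij: "i \<in> C" "j \<in> C'"
begin

lemma swap_disjoint: "C \<inter> C' = {}" "i \<notin> C'" "j \<notin> C" "i \<noteq> j"
  using equal_partitions_unique[OF P C(1,2)] C(3) ij by auto

text \<open>A retained cluster that contains \<open>j\<close> would have to be \<open>C'\<close>,
  and one that contains \<open>i\<close> would have to be \<open>C\<close>. Hence the insertions in
  \<open>swap\<close> never collapse, and sums over the swapped partition split cleanly.\<close>

lemma swap_new_clusters:
  "insert j (C - {i}) \<notin> P - {C, C'}" "insert i (C' - {j}) \<notin> P - {C, C'}"
  "insert j (C - {i}) \<noteq> insert i (C' - {j})"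
proof -
  show "insert j (C - {i}) \<notin> P - {C, C'}"
  proof
    assume *: "insert j (C - {i}) \<in> P - {C, C'}"
    then have "insert j (C - {i}) = C'"
      using ij by (intro equal_partitions_unique[OF P _ C(2), of _ j]) simp_all
    then show False using * by simp
  qed
  show "insert i (C' - {j}) \<notin> P - {C, C'}"
  proof
    assume *: "insert i (C' - {j}) \<in> P - {C, C'}"
    then have "insert i (C' - {j}) = C"
      using ij by (intro equal_partitions_unique[OF P _ C(1), of _ i]) simp_all
    then show False using * by simp
  qed
  have "j \<notin> insert i (C' - {j})" using swap_disjoint(4) by simp
  then show "insert j (C - {i}) \<noteq> insert i (C' - {j})" by (metis insertI1)
qed

text \<open>Kept general in \<open>f\<close> to serve twice: the constant 1 counts the clusters, and
  \<open>internal_edges E\<close> counts the edges inside them.\<close>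

lemma sum_swap:
  "sum f (swap P C C' i j) = f (insert j (C - {i})) + f (insert i (C' - {j})) + sum f (P - {C, C'})"
  for f :: "nat set \<Rightarrow> nat"
  using swap_new_clusters equal_partitionsD(3)[OF P] by (simp add: swap_def)

lemma sum_before_swap: "sum f P = f C + f C' + sum f (P - {C, C'})"
  for f :: "nat set \<Rightarrow> nat"
proof -
  have "P = insert C (insert C' (P - {C, C'}))" using C by auto
  also have "sum f \<dots> = f C + f C' + sum f (P - {C, C'})"
    using C equal_partitionsD(3)[OF P] by simp
  finally show ?thesis .
qed

lemma swap_in_equal_partitions: "swap P C C' i j \<in> equal_partitions n r K"
proof -
  have fin: "finite C" "finite C'" and K: "card C = K" "card C' = K"
    using equal_partitionsD(5,6)[OF P] C by auto
  have "K > 0" using K fin ij card_gt_0_iff by blast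
  then have card: "card (insert j (C - {i})) = K" "card (insert i (C' - {j})) = K"
    using fin K ij swap_disjoint by simp_all
  have "card (swap P C C' i j) = card P"
    using sum_swap[of "\<lambda>_. 1"] sum_before_swap[of "\<lambda>_. 1"] by simp
  moreover have "partition_on {..<n} (swap P C C' i j)"
  proof -
    have "\<Union>(swap P C C' i j) = \<Union>(P - {C, C'}) \<union> (C \<union> C')"
      using ij by (auto simp: swap_def)
    also have "\<dots> = \<Union>P" using C by blast
    finally have union: "\<Union>(swap P C C' i j) = {..<n}" using equal_partitionsD(1)[OF P] by simp
    have disj: "disjnt A B" if "A \<in> P" "B \<in> P" "A \<noteq> B" for A B
      using equal_partitionsD(2)[OF P] that by (auto simp: pairwise_def)
    have "disjnt (insert j (C - {i})) B" "disjnt (insert i (C' - {j})) B"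
      if "B \<in> P - {C, C'}" for B
      using disj[of B C] disj[of B C'] that C ij by (auto simp: disjnt_iff)
    moreover have "disjnt (insert j (C - {i})) (insert i (C' - {j}))"
      using swap_disjoint by (auto simp: disjnt_iff)
    ultimately have "disjoint (swap P C C' i j)"
      unfolding swap_def
      by (intro pairwise_disjnt_insertI) (use disj in \<open>auto simp: pairwise_def\<close>)
    moreover have "{} \<notin> P" using equal_partitionsD(5)[OF P] \<open>K > 0\<close> by fastforce
    ultimately show ?thesis
      using union by (auto simp: partition_on_def swap_def)
  qed
  ultimately show ?thesis
    using card equal_partitionsD(4,5)[OF P] by (auto simp: equal_partitions_def swap_def)
qed

text \<open>Old and new clusters arise by adding one vertex each to the same cores
  \<open>C - {i}\<close> and \<open>C' - {j}\<close>, so the totals differ only in the four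
  neighbour counts compared in the assumptions.\<close>

lemma internal_edges_swap:
  assumes "nbrs E i (C - {i}) \<le> nbrs E i (C' - {j})" "nbrs E j (C' - {j}) \<le> nbrs E j (C - {i})"
  shows "(\<Sum>B\<in>P. internal_edges E B) \<le> (\<Sum>B\<in>swap P C C' i j. internal_edges E B)"
proof -
  have fin: "finite C" "finite C'" using equal_partitionsD(6)[OF P] C by auto
  have "internal_edges E C = internal_edges E (C - {i}) + nbrs E i (C - {i})"
    "internal_edges E C' = internal_edges E (C' - {j}) + nbrs E j (C' - {j})"
    "internal_edges E (insert j (C - {i})) = internal_edges E (C - {i}) + nbrs E j (C - {i})"
    "internal_edges E (insert i (C' - {j})) = internal_edges E (C' - {j}) + nbrs E i (C' - {j})"
    using internal_edges_insert[of "C - {i}" i E] internal_edges_insert[of "C' - {j}" j E]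
      internal_edges_insert[of "C - {i}" j E] internal_edges_insert[of "C' - {j}" i E]
      fin ij swap_disjoint by (simp_all add: insert_absorb)
  then show ?thesis
    using assms by (simp add: sum_swap sum_before_swap)
qed

end

text \<open>The cluster of \<open>j\<close> after the swap is \<open>C\<close> with \<open>i\<close>
  replaced by \<open>j\<close>, and this reveals \<open>i\<close>. Thus one fixed \<open>j\<close>
  yields as many distinct partitions as there are choices of \<open>i\<close>.\<close>

lemma inj_on_swap:
  assumes P: "P \<in> equal_partitions n r K"
    and C: "C \<in> P" "C' \<in> P" "C \<noteq> C'" and j: "j \<in> C'"
  shows "inj_on (\<lambda>i. swap P C C' i j) C"
proof (rule inj_onI)
  fix i i' assume i: "i \<in> C" "i' \<in> C" and eq: "swap P C C' i j = swap P C C' i' j"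
  have "insert j (C - {i}) = insert j (C - {i'})"
  proof (rule equal_partitions_unique[OF swap_in_equal_partitions[OF P C i(1) j]])
    show "insert j (C - {i}) \<in> swap P C C' i j" by (simp add: swap_def)
    show "insert j (C - {i'}) \<in> swap P C C' i j" unfolding eq by (simp add: swap_def)
  qed auto
  moreover have "j \<notin> C" using swap_disjoint(3)[OF P C i(1) j] .
  ultimately show "i = i'" using i by auto
qed

section \<open>Likelihood of a graph in terms of the edges inside clusters\<close>

abbreviation edge_slots :: "nat \<Rightarrow> (nat \<times> nat) set" where
  "edge_slots n \<equiv> {(i, j). i < j \<and> j < n}"

lemma finite_edge_slots: "finite (edge_slots n)"
  by (rule finite_subset[of _ "{..<n} \<times> {..<n}"]) auto

lemma sum_internal_edges:
  assumes P: "P \<in> equal_partitions n r K"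
  shows "(\<Sum>C\<in>P. internal_edges E C) = card {(u, v) \<in> edge_slots n. same_cluster P u v \<and> E (u, v)}"
proof -
  let ?I = "\<lambda>C. {(u, v). u \<in> C \<and> v \<in> C \<and> u < v \<and> E (u, v)}"
  have "{(u, v) \<in> edge_slots n. same_cluster P u v \<and> E (u, v)} = (\<Union>C\<in>P. ?I C)"
    using equal_partitionsD(1)[OF P] by (auto simp: same_cluster_def)
  moreover have "card (\<Union>C\<in>P. ?I C) = (\<Sum>C\<in>P. card (?I C))"
  proof (rule card_UN_disjoint)
    show "finite P" using equal_partitionsD(3)[OF P] .
    show "\<forall>C\<in>P. finite (?I C)"
    proof
      fix C assume "C \<in> P"
      then have "finite (C \<times> C)" using equal_partitionsD(6)[OF P] by simp
      then show "finite (?I C)" by (rule rev_finite_subset) auto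
    qed
    show "\<forall>C\<in>P. \<forall>C'\<in>P. C \<noteq> C' \<longrightarrow> ?I C \<inter> ?I C' = {}"
    proof (intro ballI impI)
      fix B B' assume "B \<in> P" "B' \<in> P" "B \<noteq> B'"
      then have "B \<inter> B' = {}" using equal_partitions_unique[OF P] by blast
      then show "?I B \<inter> ?I B' = {}" by auto
    qed
  qed
  ultimately show ?thesis by (simp add: internal_edges_def)
qed

text \<open>Relative to the law with all edge probabilities \<open>q\<close>, only slots inside
  clusters contribute a factor. Their number \<open>r * (K choose 2)\<close> is the same for all
  equal partitions, so the likelihood depends on \<open>P\<close> only through
  \<open>x\<close>.\<close>

lemma pmf_edge_pmf:
  assumes P: "P \<in> equal_partitions n r K" and E: "\<And>e. e \<notin> edge_slots n \<Longrightarrow> \<not> E e"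
    and pq: "0 < q" "q < 1" "0 \<le> p" "p \<le> 1"
  defines "x \<equiv> \<Sum>C\<in>P. internal_edges E C"
  shows "pmf (edge_pmf n P p q) E =
    (\<Prod>e\<in>edge_slots n. pmf (bernoulli_pmf q) (E e)) *
    ((p / q) ^ x * ((1 - p) / (1 - q)) ^ (r * (K choose 2) - x))"
proof -
  let ?D = "edge_slots n"
  define S where "S = {(u, v) \<in> ?D. same_cluster P u v}"
  define X where "X = {e \<in> S. E e}"
  have finS: "finite S" unfolding S_def by (rule finite_subset[OF _ finite_edge_slots[of n]]) auto
  have cardX: "card X = x"
    unfolding x_def sum_internal_edges[OF P] X_def S_def by (rule arg_cong[of _ _ card]) auto
  have "(\<Sum>C\<in>P. internal_edges (\<lambda>_. True) C) = (\<Sum>C\<in>P. K choose 2)"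
    using equal_partitionsD(5,6)[OF P] by (intro sum.cong refl) (simp add: internal_edges_complete)
  then have cardS: "card S = r * (K choose 2)"
    unfolding sum_internal_edges[OF P] S_def using equal_partitionsD(4)[OF P] by simp
  have XS: "X \<subseteq> S" by (auto simp: X_def)
  define R where "R e = (if E e then p / q else (1 - p) / (1 - q))" for e
  have "pmf (edge_pmf n P p q) E
      = (\<Prod>e\<in>?D. pmf (case e of (i, j) \<Rightarrow> bernoulli_pmf (if same_cluster P i j then p else q)) (E e))"
    unfolding edge_pmf_def using E by (intro pmf_Pi' finite_edge_slots) auto
  also have "\<dots> = (\<Prod>e\<in>?D. pmf (bernoulli_pmf q) (E e) * (if e \<in> S then R e else 1))"
    using pq by (intro prod.cong refl) (auto simp: S_def R_def split: if_splits)
  also have "\<dots> = (\<Prod>e\<in>?D. pmf (bernoulli_pmf q) (E e)) * (\<Prod>e\<in>?D. if e \<in> S then R e else 1)"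
    by (rule prod.distrib)
  also have "(\<Prod>e\<in>?D. if e \<in> S then R e else 1) = (\<Prod>e\<in>S. R e)"
    by (rule prod.mono_neutral_cong_right[OF finite_edge_slots]) (auto simp: S_def)
  also have "\<dots> = (\<Prod>e\<in>X. R e) * (\<Prod>e\<in>S - X. R e)"
    by (subst prod.subset_diff[OF XS finS]) (simp add: mult.commute)
  also have "(\<Prod>e\<in>X. R e) = (p / q) ^ x"
    unfolding cardX[symmetric] by (simp add: R_def X_def)
  also have "(\<Prod>e\<in>S - X. R e) = (\<Prod>e\<in>S - X. (1 - p) / (1 - q))"
    by (intro prod.cong refl) (auto simp: R_def X_def)
  also have "\<dots> = ((1 - p) / (1 - q)) ^ (r * (K choose 2) - x)"
    using finS XS cardX cardS by (simp add: card_Diff_subset finite_subset)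
  finally show ?thesis .
qed

text \<open>For \<open>q \<le> p\<close> each edge inside a cluster contributes a factor at least 1
  and each missing one a factor at most 1, so maximum likelihood amounts to maximising the edges
  inside clusters.\<close>

lemma pmf_edge_pmf_mono:
  assumes P: "P \<in> equal_partitions n r K" and P': "P' \<in> equal_partitions n r K"
    and pq: "0 < q" "q \<le> p" "p < 1"
    and le: "(\<Sum>C\<in>P. internal_edges E C) \<le> (\<Sum>C\<in>P'. internal_edges E C)"
  shows "pmf (edge_pmf n P p q) E \<le> pmf (edge_pmf n P' p q) E"
proof (cases "\<exists>e. e \<notin> edge_slots n \<and> E e")
  \<comment> \<open>Outside the slots \<open>Pi_pmf\<close> forces the default \<open>False\<close>,
    so such an \<open>E\<close> has mass zero.\<close>
  case True
  then have "pmf (edge_pmf n P p q) E = 0"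
    unfolding edge_pmf_def using finite_edge_slots by (intro pmf_Pi_outside) auto
  then show ?thesis by simp
next
  case False
  let ?x = "\<Sum>C\<in>P. internal_edges E C" and ?x' = "\<Sum>C\<in>P'. internal_edges E C" and ?s = "r * (K choose 2)"
  have E: "\<not> E e" if "e \<notin> edge_slots n" for e using False that by auto
  have pmf_eq: "pmf (edge_pmf n Q p q) E = (\<Prod>e\<in>edge_slots n. pmf (bernoulli_pmf q) (E e)) *
      ((p / q) ^ (\<Sum>C\<in>Q. internal_edges E C) *
        ((1 - p) / (1 - q)) ^ (?s - (\<Sum>C\<in>Q. internal_edges E C)))"
    if "Q \<in> equal_partitions n r K" for Q
    using pq by (intro pmf_edge_pmf[OF that E]) auto
  have "((1 - p) / (1 - q)) ^ (?s - ?x) \<le> ((1 - p) / (1 - q)) ^ (?s - ?x')"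
    using le pq by (intro power_decreasing) auto
  moreover have "(p / q) ^ ?x \<le> (p / q) ^ ?x'"
    using le pq by (intro power_increasing) auto
  ultimately have "(p / q) ^ ?x * ((1 - p) / (1 - q)) ^ (?s - ?x)
      \<le> (p / q) ^ ?x' * ((1 - p) / (1 - q)) ^ (?s - ?x')"
    using pq by (intro mult_mono) auto
  then show ?thesis
    unfolding pmf_eq[OF P] pmf_eq[OF P'] by (intro mult_left_mono prod_nonneg) auto
qed

section \<open>Misplaced vertices\<close>

lemma nbrs_cong:
  assumes "\<And>e. e \<in> edge i ` S \<Longrightarrow> E e = E' e"
  shows "nbrs E i S = nbrs E' i S"
proof -
  have "{v \<in> S. E (edge i v)} = {v \<in> S. E' (edge i v)}" using assms by blast
  then show ?thesis by (simp add: nbrs_def)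
qed

lemma edge_image_slots:
  assumes "i < n" "S \<subseteq> {..<n}" "i \<notin> S"
  shows "edge i ` S \<subseteq> edge_slots n"
proof (rule image_subsetI)
  fix v assume "v \<in> S"
  then have "v < n" "i \<noteq> v" using assms by auto
  then show "edge i v \<in> edge_slots n" using assms(1) by (auto simp: edge_def)
qed

lemma same_cluster_edge:
  "(case edge i v of (u, w) \<Rightarrow> f (same_cluster P u w)) = f (same_cluster P i v)"
  by (auto simp: edge_def min_def max_def same_cluster_def intro!: arg_cong[of _ _ f])

text \<open>Distinct \<open>v\<close> use distinct slots, so the count adds up independent Bernoulli
  variables. The common parameter \<theta> lets one statement serve sets inside the cluster of
  \<open>i\<close> and sets outside it.\<close>

lemma map_pmf_nbrs_edge_pmf:
  assumes i: "i < n" "i \<notin> S" and S: "S \<subseteq> {..<n}" and \<theta>: "\<theta> \<in> {0..1}"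
    and const: "\<And>v. v \<in> S \<Longrightarrow> (if same_cluster P i v then p else q) = \<theta>"
  shows "map_pmf (\<lambda>E. nbrs E i S) (edge_pmf n P p q) = binomial_pmf (card S) \<theta>"
proof -
  let ?A = "edge i ` S" and ?\<mu> = "\<lambda>(u, v). bernoulli_pmf (if same_cluster P u v then p else q)"
  have finS: "finite S" using S finite_subset by blast
  have sub: "?A \<subseteq> edge_slots n" using i S by (intro edge_image_slots)
  have card: "card {x \<in> ?A. if x \<in> ?A then E x else False} = nbrs E i S" for E
  proof -
    have "{x \<in> ?A. if x \<in> ?A then E x else False} = edge i ` {v \<in> S. E (edge i v)}" by auto
    then show ?thesis
      unfolding nbrs_def by (simp add: card_image inj_on_subset[OF inj_edge])
  qed
  have "binomial_pmf (card S) \<theta> =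
      map_pmf (\<lambda>f. card {x \<in> ?A. f x}) (Pi_pmf ?A False (\<lambda>_. bernoulli_pmf \<theta>))"
    using finS \<theta> by (intro binomial_pmf_altdef') (auto intro!: card_image inj_on_subset[OF inj_edge])
  also have "Pi_pmf ?A False (\<lambda>_. bernoulli_pmf \<theta>) = Pi_pmf ?A False ?\<mu>"
  proof (rule Pi_pmf_cong)
    fix x assume "x \<in> ?A"
    then obtain v where v: "v \<in> S" "x = edge i v" by auto
    show "bernoulli_pmf \<theta> = ?\<mu> x"
      unfolding v(2) same_cluster_edge[of "\<lambda>b. bernoulli_pmf (if b then p else q)"] const[OF v(1)] ..
  qed (use finS in auto)
  also have "\<dots> = map_pmf (\<lambda>f x. if x \<in> ?A then f x else False) (Pi_pmf (edge_slots n) False ?\<mu>)"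
    by (rule Pi_pmf_subset[OF finite_edge_slots sub])
  finally show ?thesis
    by (simp only: map_pmf_comp edge_pmf_def card)
qed

lemma prob_edge_le:
  assumes "0 \<le> q" "q \<le> p" "p \<le> 1"
  shows "measure_pmf.prob (edge_pmf n P p q) {E. E e} \<le> p"
proof -
  let ?\<mu> = "\<lambda>(u, v). bernoulli_pmf (if same_cluster P u v then p else q)"
  have "measure_pmf.prob (edge_pmf n P p q) {E. E e} = pmf (map_pmf (\<lambda>E. E e) (edge_pmf n P p q)) True"
    by (simp add: pmf_map vimage_def)
  \<comment> \<open>Outside the slots the coordinate is constantly \<open>False\<close>, so the
    bound covers every pair \<open>e\<close>.\<close>
  also have "\<dots> = pmf (if e \<in> edge_slots n then ?\<mu> e else return_pmf False) True"
    unfolding edge_pmf_def by (subst Pi_pmf_component[OF finite_edge_slots]) simp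
  also have "\<dots> \<le> p"
    using assms by (auto split: prod.split)
  finally show ?thesis .
qed

text \<open>
  A misplaced vertex has at least as many neighbours in the other cluster as in its own, counted
  outside the samples \<open>T\<close> and \<open>T'\<close>. Leaving out the samples makes the comparisons for different vertices
  of \<open>T\<close> independent; the second condition then recovers the comparison for the whole clusters.
\<close>
definition misplaced :: "nat set \<Rightarrow> nat set \<Rightarrow> nat set \<Rightarrow> nat set \<Rightarrow> nat \<Rightarrow> (nat \<times> nat \<Rightarrow> bool) set" where
  "misplaced C T C' T' i =
     {E. nbrs E i (C - T) \<le> nbrs E i (C' - T') \<and> (\<forall>v\<in>T - {i}. \<not> E (edge i v))}"

text \<open>The second-moment bound is applied to the comparisons outside the samples
  (\<open>X\<close>) and to their intersection with the absence of edges from \<open>i\<close> into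
  its sample (\<open>misplaced\<close>). The latter condition is independent of \<open>X i\<close>
  and fails with probability at most \<open>m * p\<close>, which gives
  \<open>s = 1 - m * p\<close>.\<close>

lemma prob_few_misplaced:
  assumes P: "P \<in> equal_partitions n r K" and C: "C \<in> P" "C' \<in> P" "C \<noteq> C'"
    and T: "T \<subseteq> C" "T' \<subseteq> C'" "card T = m" "card T' = m" "0 < m"
    and pq: "0 < q" "q \<le> p" "p < 1"
  defines "\<rho> \<equiv> measure_pmf.prob (pair_pmf (binomial_pmf (K - m) p) (binomial_pmf (K - m) q)) {(u, v). u \<le> v}"
  assumes \<rho>: "\<rho> > 0"
  shows "measure_pmf.prob (edge_pmf n P p q) {E. real (card {i \<in> T. E \<in> misplaced C T C' T' i}) \<le> m * \<rho> / 2}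
           \<le> 4 / (m * \<rho>) + 8 * (m * p)"
proof -
  let ?\<mu> = "edge_pmf n P p q"
  have Cn: "C \<subseteq> {..<n}" "C' \<subseteq> {..<n}" using equal_partitionsD(7)[OF P] C by auto
  have disj: "C \<inter> C' = {}" using equal_partitions_unique[OF P C(1,2)] C(3) by auto
  have fin: "finite C" "finite C'" using Cn finite_subset by blast+
  then have finT: "finite T" "finite T'" using T finite_subset by blast+
  have cards: "card (C - T) = K - m" "card (C' - T') = K - m"
    using equal_partitionsD(5)[OF P] C T finT by (simp_all add: card_Diff_subset)
  define R where "R = (C - T) \<union> (C' - T')"
  define X where "X i = {E. nbrs E i (C - T) \<le> nbrs E i (C' - T')}" for i
  have slots: "edge i ` S \<subseteq> edge_slots n" if "i \<in> T" "S \<subseteq> {..<n}" "i \<notin> S" for i S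
    using that T(1) Cn by (intro edge_image_slots) auto
  have notin: "i \<notin> C - T" "i \<notin> C' - T'" "i \<notin> R" if "i \<in> T" for i
    using that disj T(1) by (auto simp: R_def)
  have Rn: "R \<subseteq> {..<n}" using Cn by (auto simp: R_def)
  have X_dep: "(E \<in> X i) = (E' \<in> X i)" if "\<And>e. e \<in> edge i ` R \<Longrightarrow> E e = E' e" for i E E'
  proof -
    have "nbrs E i (C - T) = nbrs E' i (C - T)" "nbrs E i (C' - T') = nbrs E' i (C' - T')"
      using that by (auto intro!: nbrs_cong simp: R_def)
    then show ?thesis by (simp add: X_def)
  qed
  have prob_X: "measure_pmf.prob ?\<mu> (X i) = \<rho>" if i: "i \<in> T" for i
  proof -
    have iC: "i \<in> C" "i < n" using i T Cn by auto
    have same: "same_cluster P i v \<longleftrightarrow> v \<in> C" for v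
      using C(1) iC equal_partitions_unique[OF P] by (auto simp: same_cluster_def)
    have 1: "map_pmf (\<lambda>E. nbrs E i (C - T)) ?\<mu> = binomial_pmf (K - m) p"
      unfolding cards(1)[symmetric] using pq iC notin[OF i] Cn same
      by (intro map_pmf_nbrs_edge_pmf) auto
    have 2: "map_pmf (\<lambda>E. nbrs E i (C' - T')) ?\<mu> = binomial_pmf (K - m) q"
      unfolding cards(2)[symmetric] using pq iC notin[OF i] Cn same disj
      by (intro map_pmf_nbrs_edge_pmf) auto
    have "map_pmf (\<lambda>E. (nbrs E i (C - T), nbrs E i (C' - T'))) ?\<mu> =
        pair_pmf (map_pmf (\<lambda>E. nbrs E i (C - T)) ?\<mu>) (map_pmf (\<lambda>E. nbrs E i (C' - T')) ?\<mu>)"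
      unfolding edge_pmf_def
    proof (rule Pi_pmf_map_pair_indep[OF finite_edge_slots])
      show "edge i ` (C - T) \<subseteq> edge_slots n" using Cn notin(1)[OF i] by (intro slots[OF i]) auto
      show "edge i ` (C - T) \<inter> edge i ` (C' - T') = {}"
        using disj by (auto simp: inj_eq[OF inj_edge])
    qed (rule nbrs_cong, blast)+
    then have "map_pmf (\<lambda>E. (nbrs E i (C - T), nbrs E i (C' - T'))) ?\<mu> =
        pair_pmf (binomial_pmf (K - m) p) (binomial_pmf (K - m) q)" by (simp only: 1 2)
    then have "\<rho> = measure_pmf.prob (map_pmf (\<lambda>E. (nbrs E i (C - T), nbrs E i (C' - T'))) ?\<mu>) {(u, v). u \<le> v}"
      by (simp only: \<rho>_def)
    then show ?thesis by (simp add: X_def vimage_def)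
  qed
  have prob_XX: "measure_pmf.prob ?\<mu> (X i \<inter> X j) = \<rho>\<^sup>2" if ij: "i \<in> T" "j \<in> T" "i \<noteq> j" for i j
  proof -
    have "measure_pmf.prob ?\<mu> {E. E \<in> X i \<and> E \<in> X j} =
        measure_pmf.prob ?\<mu> {E. E \<in> X i} * measure_pmf.prob ?\<mu> {E. E \<in> X j}"
      unfolding edge_pmf_def
    proof (rule Pi_pmf_prob_indep[OF finite_edge_slots])
      show "edge i ` R \<subseteq> edge_slots n" using Rn notin(3)[OF ij(1)] by (intro slots[OF ij(1)]) auto
      \<comment> \<open>A common slot would force \<open>i = j\<close> or put \<open>i\<close> into
        \<open>R\<close>, but \<open>R\<close> avoids the sample \<open>T\<close>.\<close>
      show "edge i ` R \<inter> edge j ` R = {}"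
        using ij notin(3) by (auto simp: edge_eq_iff)
    qed (rule X_dep, blast)+
    then show ?thesis using prob_X ij by (simp add: Int_def power2_eq_square)
  qed
  define iso where "iso i = {E. \<forall>v\<in>T - {i}. \<not> E (edge i v)}" for i
  have prob_iso: "measure_pmf.prob ?\<mu> (iso i) \<ge> 1 - m * p" if i: "i \<in> T" for i
  proof -
    have "measure_pmf.prob ?\<mu> (- iso i) = measure_pmf.prob ?\<mu> (\<Union>v\<in>T - {i}. {E. E (edge i v)})"
      by (rule arg_cong[of _ _ "measure_pmf.prob ?\<mu>"]) (auto simp: iso_def)
    also have "\<dots> \<le> (\<Sum>v\<in>T - {i}. measure_pmf.prob ?\<mu> {E. E (edge i v)})"
      using finT by (intro measure_pmf.finite_measure_subadditive_finite) auto
    also have "\<dots> \<le> (\<Sum>v\<in>T - {i}. p)" using pq by (intro sum_mono prob_edge_le) auto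
    also have "\<dots> = real (card (T - {i})) * p" by simp
    also have "\<dots> \<le> m * p"
      using pq T(3) finT(1) by (intro mult_right_mono) (auto intro: card_Diff1_le[THEN order_trans])
    finally show ?thesis
      using measure_pmf.prob_compl[of "iso i" ?\<mu>] by (simp add: Compl_eq_Diff_UNIV)
  qed
  have prob_Y: "measure_pmf.prob ?\<mu> (misplaced C T C' T' i) \<ge> \<rho> * (1 - m * p)" if i: "i \<in> T" for i
  proof -
    have "misplaced C T C' T' i = {E. E \<in> X i \<and> E \<in> iso i}"
      by (auto simp: misplaced_def X_def iso_def)
    also have "measure_pmf.prob ?\<mu> \<dots> = measure_pmf.prob ?\<mu> {E. E \<in> X i} * measure_pmf.prob ?\<mu> {E. E \<in> iso i}"
      unfolding edge_pmf_def
    proof (rule Pi_pmf_prob_indep[OF finite_edge_slots])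
      show "edge i ` R \<subseteq> edge_slots n" using Rn notin(3)[OF i] by (intro slots[OF i]) auto
      show "edge i ` R \<inter> edge i ` (T - {i}) = {}"
        using disj T by (auto simp: inj_eq[OF inj_edge] R_def)
      show "(E \<in> X i) = (E' \<in> X i)" if "\<And>e. e \<in> edge i ` R \<Longrightarrow> E e = E' e" for E E'
        using that by (rule X_dep)
      show "(E \<in> iso i) = (E' \<in> iso i)" if "\<And>e. e \<in> edge i ` (T - {i}) \<Longrightarrow> E e = E' e" for E E'
        using that by (auto simp: iso_def)
    qed
    also have "\<dots> \<ge> \<rho> * (1 - m * p)"
      using prob_X[OF i] prob_iso[OF i] \<rho> by simp
    finally show ?thesis .
  qed
  have "T \<noteq> {}" using T by auto
  have "measure_pmf.prob ?\<mu> {E. real (card {i \<in> T. E \<in> misplaced C T C' T' i}) \<le> card T * \<rho> / 2}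
      \<le> 4 / (card T * \<rho>) + 8 * (1 - (1 - m * p))"
    by (rule prob_count_le_half_mean[OF finT(1) \<open>T \<noteq> {}\<close> \<rho> prob_X prob_XX _ prob_Y])
       (auto simp: misplaced_def X_def)
  then show ?thesis using T by simp
qed

text \<open>Without edges from \<open>i\<close> into \<open>T\<close>, leaving out the sample does
  not change the count in the own cluster; on the other side, restoring \<open>T' - {j}\<close> can
  only increase it.\<close>

lemma misplaced_nbrs_le:
  assumes "finite C'" "i \<in> T" "T \<subseteq> C" "j \<in> T'" "E \<in> misplaced C T C' T' i"
  shows "nbrs E i (C - {i}) \<le> nbrs E i (C' - {j})"
proof -
  have "nbrs E i (C - {i}) = nbrs E i (C - T)"
    unfolding nbrs_def using assms by (intro arg_cong[of _ _ card]) (auto simp: misplaced_def)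
  also have "\<dots> \<le> nbrs E i (C' - T')" using assms by (auto simp: misplaced_def)
  also have "\<dots> \<le> nbrs E i (C' - {j})"
    unfolding nbrs_def using assms by (intro card_mono) auto
  finally show ?thesis .
qed

text \<open>Outside an event covered by two applications of \<open>prob_few_misplaced\<close>, both
  samples contain more than \<open>m * \<rho> / 2\<close> misplaced vertices. One such
  \<open>j\<close> is fixed and \<open>i\<close> varies, giving more than
  \<open>m * \<rho> / 2\<close> partitions of no smaller likelihood. The constant 10 is twice 4 from
  Chebyshev plus 2 from the posterior bound.\<close>

lemma average_recovery_le:
  fixes \<phi> :: "(nat \<times> nat \<Rightarrow> bool) \<Rightarrow> real mat"
  assumes r: "r \<ge> 2" and m: "0 < m" "m \<le> K" and pq: "0 < q" "q \<le> p" "p < 1"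
  defines "\<rho> \<equiv> measure_pmf.prob (pair_pmf (binomial_pmf (K - m) p) (binomial_pmf (K - m) q)) {(u, v). u \<le> v}"
  assumes \<rho>: "\<rho> > 0"
  shows "(\<Sum>P\<in>equal_partitions n r K. measure_pmf.prob (edge_pmf n P p q) {E. \<phi> E = Zstar n P})
           / real (card (equal_partitions n r K)) \<le> 10 / (m * \<rho>) + 16 * (m * p)"
proof (cases "equal_partitions n r K = {}")
  case True
  then show ?thesis using m pq \<rho> by simp
next
  case False
  let ?S = "equal_partitions n r K"
  have "\<exists>C C' T T'. C \<in> P \<and> C' \<in> P \<and> C \<noteq> C' \<and> T \<subseteq> C \<and> T' \<subseteq> C' \<and> card T = m \<and> card T' = m"
    if P: "P \<in> ?S" for P
  proof -
    have "card P \<ge> 2" using r equal_partitionsD(4)[OF P] by simp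
    then obtain C C' where C: "C \<in> P" "C' \<in> P" "C \<noteq> C'"
      by (metis card_2_iff' ex_card subset_iff)
    have "card C = K" "card C' = K" using equal_partitionsD(5)[OF P] C by auto
    then obtain T T' where "T \<subseteq> C" "card T = m" "T' \<subseteq> C'" "card T' = m"
      using m(2) by (metis ex_card)
    then show ?thesis using C by blast
  qed
  \<comment> \<open>Clusters and samples are chosen as functions of the partition alone, so they are
    fixed before the edges are drawn.\<close>
  then obtain C C' T T' where CT: "\<And>P. P \<in> ?S \<Longrightarrow> C P \<in> P \<and> C' P \<in> P \<and> C P \<noteq> C' P \<and>
      T P \<subseteq> C P \<and> T' P \<subseteq> C' P \<and> card (T P) = m \<and> card (T' P) = m"
    by metis
  define B where "B P = {E. real (card {i \<in> T P. E \<in> misplaced (C P) (T P) (C' P) (T' P) i}) \<le> m * \<rho> / 2}" for P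
  define B' where "B' P = {E. real (card {i \<in> T' P. E \<in> misplaced (C' P) (T' P) (C P) (T P) i}) \<le> m * \<rho> / 2}" for P
  have "(\<Sum>P\<in>?S. measure_pmf.prob (edge_pmf n P p q) {E. \<phi> E = Zstar n P}) / real (card ?S)
      \<le> 2 * (4 / (m * \<rho>) + 8 * (m * p)) + 1 / (m * \<rho> / 2)"
  proof (rule average_success_le[where \<Omega> = "PiE_dflt (edge_slots n) False (\<lambda>_. UNIV)" and G = "\<lambda>P. - (B P \<union> B' P)"])
    show "finite ?S" "?S \<noteq> {}" using finite_equal_partitions False by auto
    show "finite (PiE_dflt (edge_slots n) False (\<lambda>_. UNIV :: bool set))"
      by (intro finite_PiE_dflt finite_edge_slots) auto
    show "inj_on (Zstar n) ?S" using m by (intro inj_on_Zstar) auto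
    show "0 < m * \<rho> / 2" using m \<rho> by simp
  next
    fix P assume P: "P \<in> ?S"
    show "set_pmf (edge_pmf n P p q) \<subseteq> PiE_dflt (edge_slots n) False (\<lambda>_. UNIV)"
      unfolding edge_pmf_def using set_Pi_pmf_subset'[OF finite_edge_slots]
      by (fastforce simp: PiE_dflt_def)
    note ct = CT[OF P]
    have "measure_pmf.prob (edge_pmf n P p q) (- (- (B P \<union> B' P)))
        \<le> measure_pmf.prob (edge_pmf n P p q) (B P) + measure_pmf.prob (edge_pmf n P p q) (B' P)"
      by (simp add: measure_Un_le)
    also have "\<dots> \<le> (4 / (m * \<rho>) + 8 * (m * p)) + (4 / (m * \<rho>) + 8 * (m * p))"
      unfolding B_def B'_def \<rho>_def
      by (intro add_mono prob_few_misplaced[OF P]) (use ct m pq \<rho> in \<open>auto simp: \<rho>_def\<close>)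
    finally show "measure_pmf.prob (edge_pmf n P p q) (- (- (B P \<union> B' P)))
        \<le> 2 * (4 / (m * \<rho>) + 8 * (m * p))" by (simp only: mult_2)
  next
    fix P E assume P: "P \<in> ?S" and E: "E \<in> - (B P \<union> B' P)"
    note ct = CT[OF P]
    have fin: "finite (C P)" "finite (C' P)" using equal_partitionsD(6)[OF P] ct by auto
    define I where "I = {i \<in> T P. E \<in> misplaced (C P) (T P) (C' P) (T' P) i}"
    define J where "J = {i \<in> T' P. E \<in> misplaced (C' P) (T' P) (C P) (T P) i}"
    have I: "real (card I) > m * \<rho> / 2" and "real (card J) > m * \<rho> / 2"
      using E by (auto simp: B_def B'_def I_def J_def)
    moreover have "m * \<rho> / 2 > 0" using m \<rho> by simp
    \<comment> \<open>From the second sample a single misplaced vertex suffices; the number of swaps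
      comes from \<open>I\<close>.\<close>
    ultimately have "J \<noteq> {}" by (metis card.empty less_asym of_nat_0)
    then obtain j where j: "j \<in> T' P" "E \<in> misplaced (C' P) (T' P) (C P) (T P) j"
      by (auto simp: J_def)
    have IC: "I \<subseteq> C P" and jC: "j \<in> C' P" using ct j by (auto simp: I_def)
    have "inj_on (\<lambda>i. swap P (C P) (C' P) i j) I"
      using inj_on_swap[OF P _ _ _ jC, of "C P"] ct inj_on_subset[OF _ IC] by blast
    then have "card I = card ((\<lambda>i. swap P (C P) (C' P) i j) ` I)" by (simp add: card_image)
    also have "\<dots> \<le> card {P' \<in> ?S. pmf (edge_pmf n P p q) E \<le> pmf (edge_pmf n P' p q) E}"
    proof (intro card_mono)
      show "finite {P' \<in> ?S. pmf (edge_pmf n P p q) E \<le> pmf (edge_pmf n P' p q) E}"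
        using finite_equal_partitions by simp
      show "(\<lambda>i. swap P (C P) (C' P) i j) ` I
          \<subseteq> {P' \<in> ?S. pmf (edge_pmf n P p q) E \<le> pmf (edge_pmf n P' p q) E}"
      proof (intro image_subsetI CollectI conjI)
        fix i assume i: "i \<in> I"
        then have iC: "i \<in> C P" using IC by auto
        have i': "i \<in> T P" "E \<in> misplaced (C P) (T P) (C' P) (T' P) i" using i by (auto simp: I_def)
        show sw: "swap P (C P) (C' P) i j \<in> ?S"
          using ct iC jC by (intro swap_in_equal_partitions[OF P]) auto
        have "nbrs E i (C P - {i}) \<le> nbrs E i (C' P - {j})"
          using ct fin i' j(1) by (intro misplaced_nbrs_le[of _ _ "T P" _ _ "T' P"]) auto
        moreover have "nbrs E j (C' P - {j}) \<le> nbrs E j (C P - {i})"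
          using ct fin i'(1) j by (intro misplaced_nbrs_le[of _ _ "T' P" _ _ "T P"]) auto
        ultimately show "pmf (edge_pmf n P p q) E \<le> pmf (edge_pmf n (swap P (C P) (C' P) i j) p q) E"
          using ct iC jC by (intro pmf_edge_pmf_mono[OF P sw pq] internal_edges_swap[OF P]) auto
      qed
    qed
    finally show "m * \<rho> / 2 \<le> real (card {P' \<in> ?S. pmf (edge_pmf n P p q) E \<le> pmf (edge_pmf n P' p q) E})"
      using I by linarith
  qed
  also have "\<dots> = 10 / (m * \<rho>) + 16 * (m * p)" by simp
  finally show ?thesis .
qed

section \<open>Asymptotics\<close>

text \<open>With \<open>y = p + q\<close>, the first error term equals
  \<open>y / 2 - sqrt (p * q)\<close>. It remains to bound the second root below by
  \<open>1 - y / 2 - y\<^sup>2 / 2\<close>, which follows by squaring.\<close>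

lemma affinity_ge:
  fixes p q :: real
  assumes "0 \<le> p" "0 \<le> q" "p + q \<le> 1"
  shows "1 - ((sqrt p - sqrt q)\<^sup>2 / 2 + (p + q)\<^sup>2 / 2) \<le> sqrt (p * q) + sqrt ((1 - p) * (1 - q))"
proof -
  define y where "y = p + q"
  have y: "0 \<le> y" "y \<le> 1" using assms by (auto simp: y_def)
  \<comment> \<open>The last bracket decreases to 0 at \<open>y = 1\<close>, hence is nonnegative on
    the range of \<open>y\<close>.\<close>
  have "(1 - y / 2 - y\<^sup>2 / 2)\<^sup>2 = 1 - y - y\<^sup>2 * (3 / 4 - y / 2 - y\<^sup>2 / 4)"
    by (simp add: power2_eq_square algebra_simps)
  also have "\<dots> \<le> 1 - y"
  proof -
    have "y\<^sup>2 \<le> 1" using y by (simp add: power_le_one)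
    then have "0 \<le> y\<^sup>2 * (3 / 4 - y / 2 - y\<^sup>2 / 4)" using y by (intro mult_nonneg_nonneg) auto
    then show ?thesis by simp
  qed
  also have "\<dots> \<le> (1 - p) * (1 - q)" using assms by (simp add: y_def algebra_simps)
  finally have "1 - y / 2 - y\<^sup>2 / 2 \<le> sqrt ((1 - p) * (1 - q))" by (rule real_le_rsqrt)
  moreover have "(sqrt p - sqrt q)\<^sup>2 = p + q - 2 * sqrt (p * q)"
    using assms by (simp add: power2_diff real_sqrt_mult)
  ultimately show ?thesis by (simp add: y_def field_simps)
qed

text \<open>The affinity is at least \<open>1 - \<delta>\<close>, and
  \<open>ln (1 - \<delta>) \<ge> - \<delta> - 2 * \<delta>\<^sup>2\<close> for \<delta> up to 1/2.
  Passing from \<open>N\<close> to \<open>K\<close> weakens the bound, since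
  \<open>h \<le> 1\<close>, but frees it from the sample size.\<close>

lemma prob_binomial_le_binomial_ge_exp:
  fixes p q \<delta> :: real and N K :: nat
  assumes pq: "0 < p" "0 < q" "p + q \<le> 1" and NK: "N \<le> K"
  defines "\<delta> \<equiv> (sqrt p - sqrt q)\<^sup>2 / 2 + (p + q)\<^sup>2 / 2"
  assumes \<delta>: "\<delta> \<le> 1 / 2"
  shows "measure_pmf.prob (pair_pmf (binomial_pmf N p) (binomial_pmf N q)) {(u, v). u \<le> v}
           \<ge> exp (- (2 * real K * (\<delta> + 2 * \<delta>\<^sup>2))) / (4 * (4 * real K * sqrt (p * q) + 1))"
proof -
  define h where "h = sqrt (p * q) + sqrt ((1 - p) * (1 - q))"
  have lt1: "p < 1" "q < 1" using pq by auto
  have \<delta>0: "0 \<le> \<delta>" by (simp add: \<delta>_def)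
  have h_ge: "1 - \<delta> \<le> h" unfolding \<delta>_def h_def using pq by (intro affinity_ge) auto
  then have h_half: "1 / 2 \<le> h" using \<delta> by linarith
  \<comment> \<open>Each root is at most the arithmetic mean of its two factors, and the two means
    add up to 1.\<close>
  have h_le: "h \<le> 1"
    using arith_geo_mean_sqrt[of p q] arith_geo_mean_sqrt[of "1 - p" "1 - q"] pq lt1 by (simp add: h_def)
  have "exp (- (2 * real K * (\<delta> + 2 * \<delta>\<^sup>2))) = exp (real (2 * K) * (- \<delta> - 2 * \<delta>\<^sup>2))"
    by (simp add: algebra_simps)
  also have "\<dots> \<le> exp (real (2 * K) * ln (1 - \<delta>))"
    unfolding exp_le_cancel_iff using ln_one_minus_pos_lower_bound[OF \<delta>0 \<delta>] by (intro mult_left_mono) auto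
  also have "\<dots> = (1 - \<delta>) ^ (2 * K)" using \<delta> by (subst exp_of_nat_mult) simp
  also have "\<dots> \<le> h ^ (2 * K)" using h_ge \<delta> by (intro power_mono) auto
  also have "\<dots> \<le> h ^ (2 * N)" using h_half h_le NK by (intro power_decreasing) auto
  finally have num: "exp (- (2 * real K * (\<delta> + 2 * \<delta>\<^sup>2))) \<le> h ^ (2 * N)" .
  have "sqrt (p * q) / h \<le> sqrt (p * q) / (1 / 2)"
    using pq h_half by (intro divide_left_mono) auto
  then have "real N * (sqrt (p * q) / h) \<le> real K * (2 * sqrt (p * q))"
    using NK h_half pq by (intro mult_mono) auto
  then have den: "4 * (2 * real N * (sqrt (p * q) / h) + 1) \<le> 4 * (4 * real K * sqrt (p * q) + 1)" by simp
  have "0 \<le> real N * (sqrt (p * q) / h)" using h_half pq by simp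
  then have pos: "0 < 4 * (2 * real N * (sqrt (p * q) / h) + 1)" by simp
  have "exp (- (2 * real K * (\<delta> + 2 * \<delta>\<^sup>2))) / (4 * (4 * real K * sqrt (p * q) + 1))
      \<le> h ^ (2 * N) / (4 * (2 * real N * (sqrt (p * q) / h) + 1))"
    using num den pos h_half by (intro frac_le) auto
  also have "\<dots> \<le> measure_pmf.prob (pair_pmf (binomial_pmf N p) (binomial_pmf N q)) {(u, v). u \<le> v}"
    unfolding h_def by (rule prob_binomial_le_binomial_ge[OF pq(1) lt1(1) pq(2) lt1(2)])
  finally show ?thesis .
qed

text \<open>The first factor bounds the sample size from below, the second the probability \<rho>.
  Their product grows like \<open>x powr (1 - c)\<close> up to powers of the logarithm.\<close>

lemma expected_misplaced_at_top:
  fixes c r g :: real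
  assumes "c < 1" "0 < r" "0 < g"
  shows "filterlim (\<lambda>x. (x / (r * ln x ^ 2) - 1) * (exp (- (c * ln x + 1)) / (4 * (4 * (g * ln x) + 1))))
           at_top at_top"
proof -
  \<comment> \<open>In terms of \<open>d\<close> the exponent that decides the limit is a parameter
    of known sign.\<close>
  define d where "d = 1 - c"
  have "d > 0" using assms by (simp add: d_def)
  then have "filterlim (\<lambda>x. (x / (r * ln x ^ 2) - 1) * (exp ((d - 1) * ln x - 1) / (4 * (4 * (g * ln x) + 1))))
      at_top at_top"
    using assms(2,3) by real_asymp
  then show ?thesis by (simp add: d_def)
qed

text \<open>Conditioning on the uniform partition expresses the success probability as the average
  treated above, with the estimator read as a function of the edge indicators.\<close>

lemma prob_sbm_pmf:
  assumes "K > 0"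
  shows "measure_pmf.prob (sbm_pmf r K a b) {(P, A). Zhat (r * K) A = Zstar (r * K) P} =
    (\<Sum>P\<in>equal_partitions (r * K) r K.
       measure_pmf.prob (edge_pmf (r * K) P (a * ln (real (r * K)) / real (r * K)) (b * ln (real (r * K)) / real (r * K)))
         {E. Zhat (r * K) (adj_of (r * K) E) = Zstar (r * K) P}) / real (card (equal_partitions (r * K) r K))"
proof -
  let ?n = "r * K"
  let ?S = "equal_partitions ?n r K" and ?X = "{(P, A). Zhat ?n A = Zstar ?n P}"
  let ?\<mu> = "\<lambda>P. edge_pmf ?n P (a * ln (real ?n) / real ?n) (b * ln (real ?n) / real ?n)"
  have fin: "finite (set_pmf (?\<mu> P))" for P
    unfolding edge_pmf_def
    by (rule finite_subset[OF set_Pi_pmf_subset'[OF finite_edge_slots]])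
       (auto intro!: finite_PiE_dflt finite_edge_slots)
  have "sbm_pmf r K a b = pmf_of_set ?S \<bind> (\<lambda>P. map_pmf (\<lambda>E. (P, adj_of ?n E)) (?\<mu> P))"
    by (simp add: sbm_pmf_def Let_def map_pmf_def)
  then have "measure_pmf.prob (sbm_pmf r K a b) ?X =
      measure_pmf.expectation (pmf_of_set ?S \<bind> (\<lambda>P. map_pmf (\<lambda>E. (P, adj_of ?n E)) (?\<mu> P))) (indicator ?X)"
    by simp
  also have "\<dots> = (\<Sum>P\<in>?S. measure_pmf.expectation (map_pmf (\<lambda>E. (P, adj_of ?n E)) (?\<mu> P)) (indicator ?X) /\<^sub>R real (card ?S))"
    using fin equal_partitions_nonempty[OF assms]
    by (intro pmf_expectation_bind_pmf_of_set finite_equal_partitions) auto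
  also have "\<dots> = (\<Sum>P\<in>?S. measure_pmf.prob (?\<mu> P) {E. Zhat ?n (adj_of ?n E) = Zstar ?n P} / real (card ?S))"
  proof (rule sum.cong[OF refl])
    fix P
    have "measure_pmf.expectation (map_pmf (\<lambda>E. (P, adj_of ?n E)) (?\<mu> P)) (indicator ?X) =
        measure_pmf.prob (map_pmf (\<lambda>E. (P, adj_of ?n E)) (?\<mu> P)) ?X" by (simp del: integral_map_pmf)
    also have "\<dots> = measure_pmf.prob (?\<mu> P) {E. Zhat ?n (adj_of ?n E) = Zstar ?n P}"
      by (simp add: vimage_def)
    finally show "measure_pmf.expectation (map_pmf (\<lambda>E. (P, adj_of ?n E)) (?\<mu> P)) (indicator ?X) /\<^sub>R real (card ?S)
        = measure_pmf.prob (?\<mu> P) {E. Zhat ?n (adj_of ?n E) = Zstar ?n P} / real (card ?S)"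
      by (simp add: divide_inverse mult.commute)
  qed
  finally show ?thesis by (simp add: sum_divide_distrib)
qed

theorem theorem5:
  fixes r :: nat and a b :: real and Zhat :: "nat \<Rightarrow> real mat \<Rightarrow> real mat"
  assumes "r \<ge> 2" and "a > b" and "b > 0" and "sqrt a - sqrt b < sqrt (real r)"
  shows "(\<lambda>K. measure_pmf.prob (sbm_pmf r K a b)
            {(P, A). Zhat (r * K) A = Zstar (r * K) P}) \<longlonglongrightarrow> 0"
proof -
  \<comment> \<open>With \<open>n = r * K\<close>, \<open>c\<close> is the decay exponent, as
    \<open>K * (sqrt p - sqrt q)\<^sup>2 = c * ln n\<close>; \<beta> is the coefficient in
    \<open>(p + q)\<^sup>2 / 2\<close>, and \<open>g\<close> the one in
    \<open>K * sqrt (p * q) = g * ln n\<close>.\<close>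
  define c where "c = (sqrt a - sqrt b)\<^sup>2 / r"
  define \<beta> where "\<beta> = (a + b)\<^sup>2 / 2"
  define g where "g = sqrt (a * b) / r"
  have r: "real r > 0" using assms(1) by simp
  have "sqrt b < sqrt a" using assms by simp
  then have "(sqrt a - sqrt b)\<^sup>2 < (sqrt (real r))\<^sup>2" using assms(4) by (intro power_strict_mono) auto
  then have c: "c < 1" "0 < c" using r \<open>sqrt b < sqrt a\<close> by (simp_all add: c_def)
  have \<beta>: "0 < \<beta>" and g: "0 < g" using assms r by (simp_all add: \<beta>_def g_def)
  \<comment> \<open>\<open>\<delta> x\<close> is the bound on the affinity deficit at
    \<open>n = x\<close>, and \<open>M x\<close> will bound \<open>m * \<rho>\<close> from
    below.\<close>
  define \<delta> where "\<delta> x = c * r / 2 * ln x / x + \<beta> * ln x ^ 2 / x ^ 2" for x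
  define M where "M x = (x / (r * ln x ^ 2) - 1) *
    (exp (- (c * ln x + 1)) / (4 * (4 * (g * ln x) + 1)))" for x
  have M: "filterlim M at_top at_top"
    unfolding M_def by (rule expected_misplaced_at_top[OF c(1) r g])
  have x: "filterlim (\<lambda>K. real (r * K)) at_top sequentially"
    using r by (intro filterlim_compose[OF filterlim_real_sequentially] mult_nat_left_at_top) auto
  define U where "U x = 10 / M x + 16 * (a / (r * ln x))" for x
  have "((\<lambda>x. a / (r * ln x)) \<longlongrightarrow> 0) at_top" using r by real_asymp
  then have "((\<lambda>x. 10 / M x + 16 * (a / (r * ln x))) \<longlongrightarrow> 0 + 16 * 0) at_top"
    by (intro tendsto_intros real_tendsto_divide_at_top[OF tendsto_const M]) auto
  then have "(U \<longlongrightarrow> 0) at_top" by (simp add: U_def[abs_def])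
  then have U: "(\<lambda>K. U (real (r * K))) \<longlonglongrightarrow> 0" using x by (rule filterlim_compose)
  have "eventually (\<lambda>x::real. 1 < ln x) at_top" by real_asymp
  moreover have "eventually (\<lambda>x. (a + b) * ln x / x < 1) at_top" using assms(2,3) by real_asymp
  moreover have "eventually (\<lambda>x. \<delta> x < 1 / 2) at_top" unfolding \<delta>_def using r c(2) \<beta> by real_asymp
  \<comment> \<open>The leading term of \<delta> contributes exactly \<open>c * ln x\<close>; all
    other terms are of order \<open>ln x ^ 2 / x\<close>, so the slack 1 absorbs them
    eventually.\<close>
  moreover have "eventually (\<lambda>x. 2 * (x / r) * (\<delta> x + 2 * (\<delta> x)\<^sup>2) < c * ln x + 1) at_top"
    unfolding \<delta>_def using r c(2) \<beta> by real_asymp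
  moreover have "eventually (\<lambda>x. x / (r * ln x ^ 2) > 1) at_top" using r by real_asymp
  ultimately have "eventually (\<lambda>x. 1 < ln x \<and> (a + b) * ln x / x < 1 \<and> \<delta> x < 1 / 2 \<and>
      2 * (x / r) * (\<delta> x + 2 * (\<delta> x)\<^sup>2) < c * ln x + 1 \<and> x / (r * ln x ^ 2) > 1) at_top" by eventually_elim simp
  then have ev: "eventually (\<lambda>K. let x = real (r * K) in 1 < ln x \<and> (a + b) * ln x / x < 1 \<and> \<delta> x < 1 / 2 \<and>
      2 * (x / r) * (\<delta> x + 2 * (\<delta> x)\<^sup>2) < c * ln x + 1 \<and> x / (r * ln x ^ 2) > 1) sequentially"
    unfolding Let_def by (rule eventually_compose_filterlim[OF _ x])
  have bound: "eventually (\<lambda>K. measure_pmf.prob (sbm_pmf r K a b)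
      {(P, A). Zhat (r * K) A = Zstar (r * K) P} \<le> U (real (r * K))) sequentially"
    using ev eventually_gt_at_top[of 0]
  proof eventually_elim
    case (elim K)
    define n where "n = r * K"
    define x where "x = real n"
    define p where "p = a * ln x / x"
    define q where "q = b * ln x / x"
    have L: "1 < ln x" and pq1: "(a + b) * ln x / x < 1" and \<delta>: "\<delta> x < 1 / 2" and big: "x / (r * ln x ^ 2) > 1"
      and exponent: "2 * (x / r) * (\<delta> x + 2 * (\<delta> x)\<^sup>2) < c * ln x + 1"
      using elim(1) by (auto simp: Let_def x_def n_def)
    have "n > 0" using elim assms(1) by (simp add: n_def)
    then have x0: "x > 0" by (simp add: x_def)
    then have x1: "x > 1" using L ln_gt_zero_iff[of x] by linarith
    have K: "real K = x / r" using r by (simp add: x_def n_def)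
    have ab: "a > 0" using assms by simp
    have p: "0 < p" and q: "0 < q" and qp: "q \<le> p"
      unfolding p_def q_def using assms(2,3) L x0 x1 ab
      by (auto intro!: divide_pos_pos mult_pos_pos divide_right_mono mult_right_mono)
    have pq: "p + q < 1" using pq1 by (simp add: p_def q_def add_divide_distrib algebra_simps)
    have d: "(sqrt p - sqrt q)\<^sup>2 / 2 + (p + q)\<^sup>2 / 2 = \<delta> x"
    proof -
      have "sqrt p = sqrt a * sqrt (ln x / x)" "sqrt q = sqrt b * sqrt (ln x / x)"
        by (simp_all add: p_def q_def real_sqrt_mult[symmetric])
      then have "(sqrt p - sqrt q)\<^sup>2 = (sqrt a - sqrt b)\<^sup>2 * (sqrt (ln x / x))\<^sup>2"
        by (simp add: power_mult_distrib[symmetric] algebra_simps)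
      also have "(sqrt (ln x / x))\<^sup>2 = ln x / x" using L x0 x1 by simp
      finally have "(sqrt p - sqrt q)\<^sup>2 = c * r * (ln x / x)" using r by (simp add: c_def)
      moreover have "p + q = (a + b) * (ln x / x)" by (simp add: p_def q_def add_divide_distrib algebra_simps)
      then have "(p + q)\<^sup>2 = (a + b)\<^sup>2 * (ln x ^ 2 / x ^ 2)" by (simp only: power_mult_distrib power_divide)
      ultimately show ?thesis by (simp add: \<delta>_def \<beta>_def)
    qed
    have Kg: "real K * sqrt (p * q) = g * ln x"
    proof -
      have "p * q = (a * b) * (ln x / x)\<^sup>2" by (simp add: p_def q_def power2_eq_square)
      then have "sqrt (p * q) = sqrt (a * b) * (ln x / x)"
        using L x0 x1 by (simp add: real_sqrt_mult)
      then show ?thesis using x0 by (simp add: K g_def)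
    qed
    \<comment> \<open>About \<open>K / ln n ^ 2\<close> vertices: few enough that
      \<open>m * p\<close> is at most \<open>a / (r * ln n)\<close> and vanishes, yet so many that
      only a logarithmic factor is lost against \<open>K\<close>.\<close>
    define m where "m = nat \<lfloor>x / (r * ln x ^ 2)\<rfloor>"
    have m0: "0 < m" using big by (simp add: m_def)
    have m_le: "real m \<le> x / (r * ln x ^ 2)" using big by (simp add: m_def of_nat_nat)
    have m_ge: "x / (r * ln x ^ 2) - 1 \<le> real m" unfolding m_def by linarith
    have "x / (r * ln x ^ 2) \<le> x / r"
      using r L x0 x1 by (intro divide_left_mono) (auto simp: one_le_power)
    then have mK: "m \<le> K" using m_le K by (simp flip: of_nat_le_iff[where ?'a = real])
    define \<rho> where "\<rho> = measure_pmf.prob (pair_pmf (binomial_pmf (K - m) p) (binomial_pmf (K - m) q)) {(u, v). u \<le> v}"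
    define F where "F = exp (- (c * ln x + 1)) / (4 * (4 * (g * ln x) + 1))"
    have Kg4: "4 * real K * sqrt (p * q) = 4 * (g * ln x)" using Kg by simp
    have "exp (- (2 * real K * (\<delta> x + 2 * (\<delta> x)\<^sup>2))) / (4 * (4 * real K * sqrt (p * q) + 1)) \<le> \<rho>"
      unfolding \<rho>_def d[symmetric] using p q pq \<delta> d by (intro prob_binomial_le_binomial_ge_exp) auto
    then have "exp (- (2 * (x / r) * (\<delta> x + 2 * (\<delta> x)\<^sup>2))) / (4 * (4 * (g * ln x) + 1)) \<le> \<rho>"
      unfolding Kg4 unfolding K .
    moreover have gL: "0 < g * ln x" using g L x1 by simp
    moreover have "F \<le> exp (- (2 * (x / r) * (\<delta> x + 2 * (\<delta> x)\<^sup>2))) / (4 * (4 * (g * ln x) + 1))"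
      unfolding F_def using exponent gL by (intro divide_right_mono) auto
    ultimately have F_le: "F \<le> \<rho>" by linarith
    from gL have F0: "0 < F" by (simp add: F_def)
    \<comment> \<open>The two factors of \<open>M x\<close> bound \<open>m\<close> and \<rho>
      separately; the summand \<open>- 1\<close> pays for rounding down in \<open>m\<close>.\<close>
    have "M x \<le> m * \<rho>"
      unfolding M_def F_def[symmetric] using m_ge F_le F0 big by (intro mult_mono) auto
    moreover have "0 < M x" unfolding M_def F_def[symmetric] using F0 big by simp
    ultimately have 1: "10 / (m * \<rho>) \<le> 10 / M x" by (intro divide_left_mono) auto
    have "m * p \<le> x / (r * ln x ^ 2) * p" using m_le p by (intro mult_right_mono) auto
    also have "\<dots> = a / (r * ln x)" using x0 x1 L r by (simp add: p_def power2_eq_square)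
    finally have 2: "m * p \<le> a / (r * ln x)" .
    have "measure_pmf.prob (sbm_pmf r K a b) {(P, A). Zhat (r * K) A = Zstar (r * K) P}
        = (\<Sum>P\<in>equal_partitions n r K. measure_pmf.prob (edge_pmf n P p q) {E. Zhat n (adj_of n E) = Zstar n P})
           / real (card (equal_partitions n r K))"
      unfolding prob_sbm_pmf[OF elim(2)] n_def p_def q_def x_def ..
    also have "\<dots> \<le> 10 / (m * \<rho>) + 16 * (m * p)"
      unfolding \<rho>_def using F0 F_le p q qp pq m0 mK assms(1)
      by (intro average_recovery_le) (auto simp: \<rho>_def)
    also have "\<dots> \<le> U x" unfolding U_def using 1 2 by linarith
    finally show ?case by (simp only: x_def n_def)
  qed
  show ?thesis
    by (rule tendsto_sandwich[OF _ bound tendsto_const U]) auto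
qed

end
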